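(* Consider $k=3$ agents on $SO(3)$ with edge set $\mathcal{E}=\{(1,2),(1,3),(2,3)\}$, fixed reference vectors $y_{12},y_{13},y_{23}\in S^2$ (with $y_{ji}=y_{ij}$) and constant perturbations $E_{ij}\in SO(3)$, $i\neq j$, evolving according to $$\tfrac{d}{dt}Q_i=Q_i\sum_{\{j:(i,j)\in\mathcal{E}\}}\mathrm{skew}(Q_i^TE_{ij}M_{ij}E_{ji}^TQ_j),\qquad i=1,2,3,\qquad M_{ij}=y_{ij}y_{ij}^T.$$ For $\varepsilon>0$ let $E_\varepsilon=\{(E_{12},\ldots,E_{32}):\|I_3-E_{ij}\|_F<\varepsilon\ \forall i\neq j\}\subset(SO(3))^6$. (a) Assume $\mathrm{rank}(y_{12},y_{13},y_{23})=\mathrm{rank}(y_{12},y_{13})=\mathrm{rank}(y_{12},y_{23})=\mathrm{rank}(y_{13},y_{23})=2$. Then there is a constant $c>0$ such that for any sufficiently small $\varepsilon>0$ there is a set $S_\varepsilon\subset E_\varepsilon$ of non-zero measure such that, for all $(E_{12},\ldots,E_{32})\in S_\varepsilon$, $C_{o-e}(E_{12},\ldots,E_{32})$ is nonempty and $\mathrm{dist}(C_s,C_{o-e}(E_{12},\ldots,E_{32}))\ge c\sqrt{\varepsilon}$. Furthermore, for any $\varepsilon>0$ there is also a set $N_\varepsilon\subset E_\varepsilon$ of non-zero measure such that $C_{o-e}(E_{12},\ldots,E_{32})=\emptyset$ for all $(E_{12},\ldots,E_{32})\in N_\varepsilon$. (b) Assume $\mathrm{rank}(y_{12},y_{13},y_{23})=3$.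 Then there is a constant $c>0$ such that, for any sufficiently small $\varepsilon>0$, $C_{o-e}(E_{12},\ldots,E_{32})$ is non-empty and $\mathrm{dist}(C_s,C_{o-e}(E_{12},\ldots,E_{32}))\le c\,\varepsilon$ for all $(E_{12},\ldots,E_{32})\in E_\varepsilon$.
   Context: $S^2$ is the unit sphere of $\mathbb{R}^3$; $\mathrm{skew}(X)=\tfrac12(X-X^T)$; $\|M\|_F=\sqrt{\mathrm{tr}(M^TM)}$; $\mathrm{rank}(x_1,\ldots,x_m)$ is the rank of the matrix with columns $x_1,\ldots,x_m$. The perturbed outputs exchanged on edge $(i,j)$ are $Q_i^TE_{ij}y_{ij}$ and $Q_j^TE_{ji}y_{ij}$ (with $E_{ij}\ne E_{ji}$ in general). $C_s=\{(Q_1,Q_2,Q_3)\in(SO(3))^3:Q_1=Q_2=Q_3\}$. The output consensus set for perturbed outputs is $C_{o-e}(E_{12},\ldots,E_{32})=\{(Q_1,Q_2,Q_3)\in(SO(3))^3: Q_i^TE_{ij}y_{ij}=Q_j^TE_{ji}y_{ij}\ \forall(i,j)\in\mathcal{E}\}$. The distance is $$\mathrm{dist}^2(C_A,C_B)=\min_{(Q_{1A},\ldots,Q_{kA})\in C_A,\ (Q_{1B},\ldots,Q_{kB})\in C_B}\ \sum_{i=1}^k\|Q_{iA}-Q_{iB}\|_F^2 .$$ Measure on $(SO(3))^6$ is the standard (Riemannian/Haar) measure. *)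

theory Defs
  imports "HOL-Analysis.Analysis"
begin

type_synonym vec3 = "real^3"
type_synonym mat3 = "real^3^3"

subsection \<open>Matrices\<close>

definition SO3 :: "mat3 set" where
  "SO3 = {Q. rotation_matrix Q}"

definition skew :: "mat3 \<Rightarrow> mat3" where
  "skew X = (1/2) *\<^sub>R (X - transpose X)"

definition frob_norm :: "mat3 \<Rightarrow> real" where
  "frob_norm M = sqrt (trace (transpose M ** M))"

definition rank_of2 :: "vec3 \<Rightarrow> vec3 \<Rightarrow> nat" where
  "rank_of2 a b = rank (transpose (vector [a, b] :: real^3^2))"

definition rank_of3 :: "vec3 \<Rightarrow> vec3 \<Rightarrow> vec3 \<Rightarrow> nat" where
  "rank_of3 a b c = rank (transpose (vector [a, b, c] :: real^3^3))"

definition outer :: "vec3 \<Rightarrow> mat3" where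
  "outer v = (columnvector v :: real^1^3) ** (rowvector v :: real^3^1)"

subsection \<open>Three agents on a complete graph\<close>

definition agents :: "nat set" where
  "agents = {1, 2, 3}"

definition edges :: "(nat \<times> nat) set" where
  "edges = {(1, 2), (1, 3), (2, 3)}"

text \<open>The graph is undirected: every edge is listed with its smaller endpoint first, while
  an agent interacts with both kinds of neighbours and the perturbations are indexed by the
  six ordered pairs of distinct agents.\<close>

definition neighbours :: "nat \<Rightarrow> nat set" where
  "neighbours i = {j. (i, j) \<in> edges \<or> (j, i) \<in> edges}"

definition arcs :: "(nat \<times> nat) set" where
  "arcs = {(i, j). i \<in> agents \<and> j \<in> agents \<and> i \<noteq> j}"

definition configurations :: "(nat \<Rightarrow> mat3) set" where
  "configurations = (\<Pi>\<^sub>E i\<in>agents. SO3)"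

definition perturbations :: "(nat \<times> nat \<Rightarrow> mat3) set" where
  "perturbations = (\<Pi>\<^sub>E a\<in>arcs. SO3)"

definition small_perturbations :: "real \<Rightarrow> (nat \<times> nat \<Rightarrow> mat3) set" where
  "small_perturbations \<epsilon> = {E \<in> perturbations. \<forall>a\<in>arcs. frob_norm (mat 1 - E a) < \<epsilon>}"

definition consensus_field ::
  "(nat \<times> nat \<Rightarrow> vec3) \<Rightarrow> (nat \<times> nat \<Rightarrow> mat3) \<Rightarrow> (nat \<Rightarrow> mat3) \<Rightarrow> nat \<Rightarrow> mat3" where
  "consensus_field y E Q i =
     Q i ** (\<Sum>j\<in>neighbours i.
       skew (transpose (Q i) ** E (i, j) ** outer (y (i, j)) ** transpose (E (j, i)) ** Q j))"

definition consensus_flow ::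
  "(nat \<times> nat \<Rightarrow> vec3) \<Rightarrow> (nat \<times> nat \<Rightarrow> mat3) \<Rightarrow> (real \<Rightarrow> nat \<Rightarrow> mat3) \<Rightarrow> bool" where
  "consensus_flow y E Q \<longleftrightarrow>
     (\<forall>t\<ge>0. Q t \<in> configurations \<and>
        (\<forall>i\<in>agents. ((\<lambda>s. Q s i) has_vector_derivative consensus_field y E (Q t) i)
                       (at t within {0..})))"

subsection \<open>Consensus sets and their distance\<close>

definition state_consensus :: "(nat \<Rightarrow> mat3) set" where
  "state_consensus = {Q \<in> configurations. Q 1 = Q 2 \<and> Q 2 = Q 3}"

definition output_consensus ::
  "(nat \<times> nat \<Rightarrow> vec3) \<Rightarrow> (nat \<times> nat \<Rightarrow> mat3) \<Rightarrow> (nat \<Rightarrow> mat3) set" where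
  "output_consensus y E =
     {Q \<in> configurations. \<forall>(i, j)\<in>edges.
        transpose (Q i) *v (E (i, j) *v y (i, j)) = transpose (Q j) *v (E (j, i) *v y (i, j))}"

text \<open>The infimum is a minimum for nonempty compact arguments, in particular for the two
  consensus sets; for an empty argument the value is unspecified.\<close>

definition set_dist :: "(nat \<Rightarrow> mat3) set \<Rightarrow> (nat \<Rightarrow> mat3) set \<Rightarrow> real" where
  "set_dist A B = sqrt (INF (P, Q) \<in> A \<times> B. \<Sum>i\<in>agents. (frob_norm (P i - Q i))\<^sup>2)"

subsection \<open>Haar measure\<close>

text \<open>The normalised Haar measure of the compact group of rotations; the normalised
  Riemannian volume of the bi-invariant metric is the same measure.\<close>

definition haar_SO3 :: "mat3 measure \<Rightarrow> bool" where
  "haar_SO3 \<mu> \<longleftrightarrow>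
     sets \<mu> = sets (restrict_space borel SO3) \<and>
     emeasure \<mu> SO3 = 1 \<and>
     (\<forall>R\<in>SO3. \<forall>A\<in>sets \<mu>. emeasure \<mu> ((\<lambda>Q. R ** Q) ` A) = emeasure \<mu> A)"

subsection \<open>Existence of solutions of the consensus flow\<close>

text \<open>For symmetric reference vectors the flow is a gradient flow on a compact set, so a constant
  trajectory at a maximiser of the potential is a solution.\<close>

lemma symmetric_if_maximal:
  assumes max: "\<And>R. R \<in> SO3 \<Longrightarrow> trace (transpose R ** B) \<le> trace B"
  shows "skew B = 0"
proof -
  have *: "b = 0" if h: "\<And>c s. c\<^sup>2 + s\<^sup>2 = 1 \<Longrightarrow> c * a + s * b \<le> a" for a b :: real
  proof (rule ccontr)
    assume "b \<noteq> 0"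
    define r where "r = sqrt (a\<^sup>2 + b\<^sup>2)"
    have r2: "r\<^sup>2 = a\<^sup>2 + b\<^sup>2" by (simp add: r_def)
    have rp: "r > 0" using \<open>b \<noteq> 0\<close> by (simp add: r_def sum_power2_gt_zero_iff)
    have "(a/r) * a + (b/r) * b \<le> a"
      using rp by (intro h) (simp add: power_divide r2[symmetric] flip: add_divide_distrib)
    moreover have "(a/r) * a + (b/r) * b = r"
      using r2 rp by (simp add: field_simps power2_eq_square)
    ultimately have "r \<le> a" by simp
    then have "r\<^sup>2 \<le> a\<^sup>2" using rp by (intro power_mono) auto
    with r2 \<open>b \<noteq> 0\<close> show False by simp
  qed
  note defs = SO3_def rotation_matrix_def orthogonal_matrix matrix_matrix_mult_def transpose_def
    mat_def vec_eq_iff forall_3 sum_3 det_3 trace_def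
  have 12: "B $ 2 $ 1 - B $ 1 $ 2 = 0"
  proof (rule *[where a = "B$1$1 + B$2$2"])
    fix c s :: real assume cs: "c\<^sup>2 + s\<^sup>2 = 1"
    define R :: mat3 where "R = vector [vector [c, -s, 0], vector [s, c, 0], vector [0, 0, 1]]"
    have "R \<in> SO3" using cs by (simp add: defs R_def power2_eq_square add.commute)
    from max[OF this] show "c * (B$1$1 + B$2$2) + s * (B $ 2 $ 1 - B $ 1 $ 2) \<le> B$1$1 + B$2$2"
      by (simp add: defs R_def algebra_simps)
  qed
  have 13: "B $ 3 $ 1 - B $ 1 $ 3 = 0"
  proof (rule *[where a = "B$1$1 + B$3$3"])
    fix c s :: real assume cs: "c\<^sup>2 + s\<^sup>2 = 1"
    define R :: mat3 where "R = vector [vector [c, 0, -s], vector [0, 1, 0], vector [s, 0, c]]"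
    have "R \<in> SO3" using cs by (simp add: defs R_def power2_eq_square add.commute)
    from max[OF this] show "c * (B$1$1 + B$3$3) + s * (B $ 3 $ 1 - B $ 1 $ 3) \<le> B$1$1 + B$3$3"
      by (simp add: defs R_def algebra_simps)
  qed
  have 23: "B $ 3 $ 2 - B $ 2 $ 3 = 0"
  proof (rule *[where a = "B$2$2 + B$3$3"])
    fix c s :: real assume cs: "c\<^sup>2 + s\<^sup>2 = 1"
    define R :: mat3 where "R = vector [vector [1, 0, 0], vector [0, c, -s], vector [0, s, c]]"
    have "R \<in> SO3" using cs by (simp add: defs R_def power2_eq_square add.commute)
    from max[OF this] show "c * (B$2$2 + B$3$3) + s * (B $ 3 $ 2 - B $ 2 $ 3) \<le> B$2$2 + B$3$3"
      by (simp add: defs R_def algebra_simps)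
  qed
  show ?thesis using 12 13 23
    by (simp add: skew_def vec_eq_iff forall_3 transpose_def)
qed

lemma SO3_mult: "A \<in> SO3 \<Longrightarrow> B \<in> SO3 \<Longrightarrow> A ** B \<in> SO3"
  by (simp add: SO3_def rotation_matrix_def orthogonal_matrix_mul det_mul)

lemma SO3_transpose: "A \<in> SO3 \<Longrightarrow> transpose A \<in> SO3"
  by (simp add: SO3_def rotation_matrix_def orthogonal_matrix_transpose)

lemma compact_SO3: "compact SO3"
proof -
  have eq: "SO3 = {Q. transpose Q ** Q = mat 1} \<inter> {Q. det Q = 1}"
    by (auto simp: SO3_def rotation_matrix_def orthogonal_matrix)
  have "continuous_on UNIV (\<lambda>Q::mat3. \<chi> i j. \<Sum>k\<in>UNIV. Q $ k $ i * Q $ k $ j)"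
    by (intro continuous_on_vec_lambda continuous_on_sum continuous_on_mult
        continuous_on_component continuous_on_id)
  then have c1: "closed {Q::mat3. transpose Q ** Q = mat 1}"
    by (intro closed_Collect_eq continuous_on_const)
      (simp add: matrix_matrix_mult_def transpose_def)
  have c2: "closed {Q::mat3. det Q = 1}"
    unfolding det_3
    by (intro closed_Collect_eq continuous_on_const continuous_on_add continuous_on_diff
        continuous_on_mult continuous_on_component continuous_on_id)
  have "closed SO3" unfolding eq by (rule closed_Int[OF c1 c2])
  moreover have "bounded SO3"
  proof (rule boundedI)
    fix Q assume "Q \<in> SO3"
    then have "norm (row i Q) = 1" for i
      by (simp add: SO3_def rotation_matrix_def orthogonal_matrix_orthonormal_rows)
    then have r: "norm (Q $ i) = 1" for i by (simp add: row_def vec_lambda_eta)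
    have "norm Q \<le> (\<Sum>i\<in>UNIV. norm (Q $ i))" 
      unfolding norm_vec_def by (intro L2_set_le_sum) auto
    also have "\<dots> = 3" by (simp add: r)
    finally show "norm Q \<le> 3" .
  qed
  ultimately show ?thesis by (simp add: compact_eq_bounded_closed)
qed

lemma trace_transpose: "trace (transpose (X::mat3)) = trace X"
  by (simp add: trace_def transpose_def)

lemma equilibrium:
  fixes A B C :: mat3
  obtains P Q R where "P \<in> SO3" "Q \<in> SO3" "R \<in> SO3"
    "skew (transpose P ** A ** Q) + skew (transpose P ** B ** R) = 0"
    "skew (transpose Q ** transpose A ** P) + skew (transpose Q ** C ** R) = 0"
    "skew (transpose R ** transpose B ** P) + skew (transpose R ** transpose C ** Q) = 0"
proof -
  define f :: "mat3 \<times> mat3 \<times> mat3 \<Rightarrow> real" where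
    "f = (\<lambda>(P,Q,R). trace (transpose P ** A ** Q) + trace (transpose P ** B ** R)
            + trace (transpose Q ** C ** R))"
  have I: "mat 1 \<in> SO3" by (simp add: SO3_def rotation_matrix_def orthogonal_matrix_id)
  have "continuous_on (SO3 \<times> SO3 \<times> SO3) f"
    unfolding f_def case_prod_unfold trace_def matrix_matrix_mult_def transpose_def
    by (simp, intro continuous_intros)
  moreover have "compact (SO3 \<times> SO3 \<times> SO3)" by (intro compact_Times compact_SO3)
  moreover have "SO3 \<times> SO3 \<times> SO3 \<noteq> {}" using I by blast
  ultimately obtain x where x: "x \<in> SO3 \<times> SO3 \<times> SO3" "\<And>z. z \<in> SO3 \<times> SO3 \<times> SO3 \<Longrightarrow> f z \<le> f x"
    by (meson continuous_attains_sup)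
  obtain P Q R where PQR: "x = (P,Q,R)" by (cases x) auto
  have m: "P \<in> SO3" "Q \<in> SO3" "R \<in> SO3" using x PQR by auto
  have tadd: "trace (X + Y) = trace X + trace Y" for X Y :: mat3 by (rule trace_add)
  have sadd: "skew X + skew Y = skew (X + Y)" for X Y
    by (simp add: skew_def vec_eq_iff transpose_def field_simps)
  have tt: "trace (transpose X ** Y ** Z) = trace (transpose Z ** transpose Y ** X)" for X Y Z :: mat3
    using trace_transpose[of "transpose X ** Y ** Z"]
    by (simp add: matrix_transpose_mul transpose_transpose matrix_mul_assoc)
  have "skew (transpose P ** A ** Q + transpose P ** B ** R) = 0"
  proof (rule symmetric_if_maximal)
    fix S assume S: "S \<in> SO3"
    have "f (P ** S, Q, R) \<le> f (P, Q, R)" using x(2)[of "(P ** S, Q, R)"] m S PQR by (auto intro: SO3_mult)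
    then show "trace (transpose S ** (transpose P ** A ** Q + transpose P ** B ** R))
        \<le> trace (transpose P ** A ** Q + transpose P ** B ** R)"
      by (simp add: f_def tadd matrix_add_ldistrib matrix_transpose_mul matrix_mul_assoc)
  qed
  moreover have "skew (transpose Q ** transpose A ** P + transpose Q ** C ** R) = 0"
  proof (rule symmetric_if_maximal)
    fix S assume S: "S \<in> SO3"
    have "f (P, Q ** S, R) \<le> f (P, Q, R)" using x(2)[of "(P, Q ** S, R)"] m S PQR by (auto intro: SO3_mult)
    then show "trace (transpose S ** (transpose Q ** transpose A ** P + transpose Q ** C ** R))
        \<le> trace (transpose Q ** transpose A ** P + transpose Q ** C ** R)"
      by (simp add: f_def tadd matrix_add_ldistrib matrix_transpose_mul matrix_mul_assoc tt[of P A])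
  qed
  moreover have "skew (transpose R ** transpose B ** P + transpose R ** transpose C ** Q) = 0"
  proof (rule symmetric_if_maximal)
    fix S assume S: "S \<in> SO3"
    have "f (P, Q, R ** S) \<le> f (P, Q, R)" using x(2)[of "(P, Q, R ** S)"] m S PQR by (auto intro: SO3_mult)
    then show "trace (transpose S ** (transpose R ** transpose B ** P + transpose R ** transpose C ** Q))
        \<le> trace (transpose R ** transpose B ** P + transpose R ** transpose C ** Q)"
      by (simp add: f_def tadd matrix_add_ldistrib matrix_transpose_mul matrix_mul_assoc
          tt[of P B] tt[of Q C])
  qed
  ultimately show ?thesis using that m by (simp add: sadd)
qed

lemma outer_sym: "transpose (outer v) = outer v"
  by (simp add: outer_def columnvector_def rowvector_def matrix_matrix_mult_def transpose_def vec_eq_iff mult.commute)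

lemma ex_consensus_flow:
  assumes y: "\<And>i j. (i, j) \<in> edges \<Longrightarrow> y (j, i) = y (i, j)"
  shows "\<exists>Q. consensus_flow y E Q"
proof -
  define A where "A i j = E (i, j) ** outer (y (i, j)) ** transpose (E (j, i))" for i j
  have AT: "A j i = transpose (A i j)" if "(i, j) \<in> edges" for i j
    using y[OF that] 
    by (simp add: A_def matrix_transpose_mul transpose_transpose outer_sym matrix_mul_assoc)
  have e: "(1,2) \<in> edges" "(1,3) \<in> edges" "(2,3) \<in> edges" by (auto simp: edges_def)
  obtain P1 P2 P3 where P: "P1 \<in> SO3" "P2 \<in> SO3" "P3 \<in> SO3"
    "skew (transpose P1 ** A 1 2 ** P2) + skew (transpose P1 ** A 1 3 ** P3) = 0"
    "skew (transpose P2 ** A 2 1 ** P1) + skew (transpose P2 ** A 2 3 ** P3) = 0"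
    "skew (transpose P3 ** A 3 1 ** P1) + skew (transpose P3 ** A 3 2 ** P2) = 0"
    using equilibrium[of "A 1 2" "A 1 3" "A 2 3"] AT[OF e(1)] AT[OF e(2)] AT[OF e(3)] by metis
  define Q :: "nat \<Rightarrow> mat3" where "Q = (\<lambda>i\<in>agents. if i = 1 then P1 else if i = 2 then P2 else P3)"
  have Q: "Q 1 = P1" "Q 2 = P2" "Q 3 = P3" by (auto simp: Q_def agents_def)
  have nb: "neighbours 1 = {2,3}" "neighbours 2 = {1,3}" "neighbours 3 = {1,2}"
    by (auto simp: neighbours_def edges_def)
  have "consensus_field y E Q i = Q i ** (\<Sum>j\<in>neighbours i. skew (transpose (Q i) ** A i j ** Q j))" for i
    by (simp add: consensus_field_def A_def matrix_mul_assoc)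
  moreover have "(\<Sum>j\<in>neighbours i. skew (transpose (Q i) ** A i j ** Q j)) = 0" if "i \<in> agents" for i
    using that P by (auto simp: agents_def nb Q simp del: One_nat_def)
  moreover have "X ** 0 = 0" for X :: mat3
    by (simp add: matrix_matrix_mult_def vec_eq_iff)
  ultimately have "consensus_field y E Q i = 0" if "i \<in> agents" for i
    using that by simp
  moreover have "Q \<in> configurations" using P by (auto simp: configurations_def Q_def)
  ultimately have "consensus_flow y E (\<lambda>_. Q)"
    by (auto simp: consensus_flow_def)
  then show ?thesis by blast
qed

subsection \<open>Existence of the Haar measure\<close>

text \<open>The measure is the image of Lebesgue measure on pairs of linearly independent vectors of
  the unit ball under Gram-Schmidt orthonormalisation.\<close>

lemma SO3_orthogonal_transformation: "R \<in> SO3 \<Longrightarrow> orthogonal_transformation ((*v) R)"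
  by (simp add: SO3_def rotation_matrix_def orthogonal_transformation_matrix matrix_of_matrix_vector_mul)

definition frame :: "vec3 \<times> vec3 \<Rightarrow> mat3" where
  "frame = (\<lambda>(u, v). let a = u /\<^sub>R norm u; c = cross3 u v /\<^sub>R norm (cross3 u v)
     in transpose (vector [a, cross3 c a, c]))"

definition frames :: "(vec3 \<times> vec3) set" where
  "frames = {(u, v) \<in> ball 0 1 \<times> ball 0 1. cross3 u v \<noteq> 0}"

lemma frame_in_SO3: "x \<in> frames \<Longrightarrow> frame x \<in> SO3"
proof -
  assume x: "x \<in> frames"
  obtain u v where uv: "x = (u, v)" by (cases x)
  define a where "a = u /\<^sub>R norm u"
  define c where "c = cross3 u v /\<^sub>R norm (cross3 u v)"
  define b where "b = cross3 c a"
  have nz: "cross3 u v \<noteq> 0" "u \<noteq> 0" using x uv by (auto simp: frames_def)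
  have aa: "a \<bullet> a = 1" and cc: "c \<bullet> c = 1"
    using nz by (auto simp: a_def c_def dot_square_norm power2_eq_square)
  have ac: "a \<bullet> c = 0" by (simp add: a_def c_def dot_cross_self)
  have ba: "b \<bullet> a = 0" and bc: "b \<bullet> c = 0" by (simp_all add: b_def dot_cross_self)
  have bb: "b \<bullet> b = 1"
  proof -
    have "norm a = 1" "norm c = 1" "c \<bullet> a = 0" using aa cc ac by (simp_all add: norm_eq_1 inner_commute[of c a])
    then show ?thesis using norm_cross_dot[of c a] by (simp add: b_def power2_norm_eq_inner)
  qed
  have sym: "c \<bullet> a = 0" "a \<bullet> b = 0" "c \<bullet> b = 0"
    using ac ba bc by (simp_all only: inner_commute)
  have "a \<bullet> cross3 b c = 1"
  proof -
    have "a \<bullet> cross3 b c = b \<bullet> cross3 c a" by (simp add: cross3_simps)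
    then show ?thesis using bb b_def by simp
  qed
  then have "det (vector [a, b, c] :: mat3) = 1" by (simp add: dot_cross_det)
  moreover have "orthogonal_matrix (vector [a, b, c] :: mat3)"
    using aa bb cc ac ba bc sym
    by (simp add: orthogonal_matrix_orthonormal_rows row_def vec_lambda_eta forall_3 
         norm_eq_1 orthogonal_def)
  moreover have "frame x = transpose (vector [a, b, c])"
    by (simp add: uv frame_def Let_def a_def b_def c_def)
  ultimately show ?thesis by (simp add: SO3_def rotation_matrix_def orthogonal_matrix_transpose)
qed

lemma frame_rotate:
  assumes R: "R \<in> SO3"
  shows "frame (R *v u, R *v v) = R ** frame (u, v)"
proof -
  have o: "norm (R *v x) = norm x" for x
    using R by (simp add: SO3_orthogonal_transformation orthogonal_transformation_norm)
  have x: "cross3 (R *v x) (R *v y) = R *v cross3 x y" for x y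
    using R by (simp add: SO3_def cross_rotation_matrix)
  have s: "k *\<^sub>R (R *v x) = R *v (k *\<^sub>R x)" for k x
    by (rule matrix_vector_mult_scaleR[symmetric])
  have c: "transpose (vector [R *v a, R *v b, R *v c]) = R ** transpose (vector [a, b, c] :: mat3)" for a b c
  proof -
    have "transpose (vector [R *v a, R *v b, R *v c]) $ i $ j =
        (R ** transpose (vector [a, b, c] :: mat3)) $ i $ j" for i j
      using exhaust_3[of j] by (auto simp: transpose_def matrix_matrix_mult_def matrix_vector_mult_def)
    then show ?thesis by (simp add: vec_eq_iff)
  qed
  show ?thesis unfolding frame_def Let_def case_prod_conv o x s c ..
qed

lemma frames_rotate:
  assumes R: "R \<in> SO3"
  shows "(R *v u, R *v v) \<in> frames \<longleftrightarrow> (u, v) \<in> frames"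
proof -
  have o: "norm (R *v x) = norm x" for x
    using R by (simp add: SO3_orthogonal_transformation orthogonal_transformation_norm)
  have x: "cross3 (R *v x) (R *v y) = R *v cross3 x y" for x y
    using R by (simp add: SO3_def cross_rotation_matrix)
  have "R *v w = 0 \<longleftrightarrow> w = 0" for w 
    using o[of w] norm_eq_zero[of "R *v w"] norm_eq_zero[of w] by argo
  then show ?thesis
    by (simp only: frames_def mem_Collect_eq case_prod_conv mem_Times_iff fst_conv snd_conv
        mem_ball_0 o x)
qed

lemma continuous_cross_pair: "continuous_on UNIV (\<lambda>x::vec3 \<times> vec3. cross3 (fst x) (snd x))"
  by (rule continuous_on_cross[OF continuous_on_fst[OF continuous_on_id] continuous_on_snd[OF continuous_on_id]])

lemma open_frames: "open frames"
proof -
  have eq: "frames = (ball 0 1 \<times> ball 0 1) \<inter> {x. cross3 (fst x) (snd x) \<noteq> 0}"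
    by (auto simp: frames_def)
  have "open {x::vec3 \<times> vec3. cross3 (fst x) (snd x) \<noteq> 0}"
    by (rule open_Collect_neq[OF continuous_cross_pair continuous_on_const])
  then show ?thesis unfolding eq by (intro open_Int open_Times open_ball)
qed

lemma continuous_frame: "continuous_on frames frame"
proof -
  have 1: "continuous_on frames (\<lambda>x. cross3 (fst x) (snd x))"
    using continuous_cross_pair continuous_on_subset by blast
  have nz: "fst x \<noteq> 0" "cross3 (fst x) (snd x) \<noteq> 0" if "x \<in> frames" for x
    using that by (auto simp: frames_def)
  have a: "continuous_on frames (\<lambda>x. fst x /\<^sub>R norm (fst x))"
    using nz by (intro continuous_intros) auto
  have c: "continuous_on frames (\<lambda>x. cross3 (fst x) (snd x) /\<^sub>R norm (cross3 (fst x) (snd x)))"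
    using nz by (intro continuous_intros 1) auto
  have b: "continuous_on frames (\<lambda>x. cross3 (cross3 (fst x) (snd x) /\<^sub>R norm (cross3 (fst x) (snd x)))
              (fst x /\<^sub>R norm (fst x)))"
    by (rule continuous_on_cross[OF c a])
  have "continuous_on frames (\<lambda>x. frame x $ i $ j)" for i j
    using continuous_on_component[OF a, of i] continuous_on_component[OF b, of i] continuous_on_component[OF c, of i]
      exhaust_3[of j]
    by (auto simp: frame_def case_prod_unfold Let_def transpose_def)
  then have "continuous_on frames (\<lambda>x. \<chi> i j. frame x $ i $ j)"
    by (intro continuous_on_vec_lambda)
  then show ?thesis by simp
qed

lemma distr_lborel_rotation:
  assumes R: "R \<in> SO3"
  shows "distr lborel borel ((*v) R) = (lborel :: vec3 measure)"
proof (rule lborel_eqI[symmetric])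
  fix l u :: vec3 assume le: "\<And>b. b \<in> Basis \<Longrightarrow> l \<bullet> b \<le> u \<bullet> b"
  have oR: "orthogonal_matrix R" using R by (simp add: SO3_def rotation_matrix_def)
  have T: "orthogonal_transformation ((*v) (transpose R))"
    using oR by (simp add: orthogonal_transformation_matrix matrix_of_matrix_vector_mul orthogonal_matrix_transpose)
  have inv: "transpose R *v (R *v x) = x" "R *v (transpose R *v x) = x" for x
    using oR by (metis matrix_vector_mul_assoc matrix_vector_mul_lid orthogonal_matrix_def)+
  have m: "(*v) R \<in> borel_measurable borel"
    by (intro borel_measurable_continuous_onI matrix_vector_mult_linear_continuous_on)
  have pre: "(*v) R -` box l u = (*v) (transpose R) ` box l u"
  proof safe
    fix x assume "R *v x \<in> box l u" 
    then show "x \<in> (*v) (transpose R) ` box l u" using inv(1) by (metis imageI)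
  qed (simp only: vimage_eq inv)
  have b: "(*v) R -` box l u \<in> sets borel" using m by (metis measurable_sets_borel box_borel)
  have lm: "(*v) (transpose R) ` box l u \<in> lmeasurable"
    by (rule measurable_orthogonal_image[OF T]) auto
  have "emeasure (distr lborel borel ((*v) R)) (box l u) = emeasure lborel ((*v) R -` box l u)"
    using m by (simp add: emeasure_distr)
  also have "\<dots> = emeasure lebesgue ((*v) R -` box l u)" using b by simp
  also have "\<dots> = ennreal (measure lebesgue ((*v) (transpose R) ` box l u))"
    using lm by (simp add: pre emeasure_eq_measure2)
  also have "measure lebesgue ((*v) (transpose R) ` box l u) = measure lebesgue (box l u)"
    by (rule measure_orthogonal_image[OF T]) auto
  also have "ennreal \<dots> = emeasure lborel (box l u)"
    by (simp add: emeasure_eq_measure2[symmetric])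
  also have "\<dots> = (\<Prod>b\<in>Basis. (u - l) \<bullet> b)"
    using le by (simp add: emeasure_lborel_box)
  finally show "emeasure (distr lborel borel ((*v) R)) (box l u) = (\<Prod>b\<in>Basis. (u - l) \<bullet> b)" .
qed simp

lemma distr_lborel_rotation2:
  assumes R: "R \<in> SO3"
  shows "distr lborel borel (\<lambda>(u, v). (R *v u, R *v v)) = (lborel :: (vec3 \<times> vec3) measure)"
proof -
  have m: "(*v) R \<in> borel_measurable lborel"
    by (simp, intro borel_measurable_continuous_onI matrix_vector_mult_linear_continuous_on)
  have "lborel \<Otimes>\<^sub>M lborel = distr lborel borel ((*v) R) \<Otimes>\<^sub>M distr lborel borel ((*v) R)"
    by (simp add: distr_lborel_rotation[OF R])
  also have "\<dots> = distr (lborel \<Otimes>\<^sub>M lborel) (borel \<Otimes>\<^sub>M borel) (\<lambda>(u, v). (R *v u, R *v v))"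
    by (rule pair_measure_distr[OF m m]) (simp add: distr_lborel_rotation[OF R] lborel.sigma_finite_measure_axioms)
  finally show ?thesis by (simp add: lborel_prod borel_prod)
qed

lemma ex_haar_SO3: "\<exists>\<mu>. haar_SO3 \<mu>"
proof -
  define U where "U = restrict_space (lborel :: (vec3 \<times> vec3) measure) frames"
  define \<nu> where "\<nu> = distr U (restrict_space borel SO3) frame"
  have F: "frames \<in> sets borel" using open_frames by simp
  have fm: "frame \<in> measurable U (restrict_space borel SO3)"
  proof (rule measurable_restrict_space2)
    show "frame \<in> space U \<rightarrow> SO3" by (auto simp: U_def space_restrict_space frame_in_SO3)
    have "frame \<in> borel_measurable (restrict_space borel frames)"
      by (rule borel_measurable_continuous_on_restrict[OF continuous_frame])
    moreover have "sets U = sets (restrict_space borel frames)"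
      by (simp add: U_def sets_restrict_space)
    ultimately show "frame \<in> borel_measurable U" by (metis measurable_cong_sets)
  qed
  have eU: "emeasure \<nu> A = emeasure lborel (frame -` A \<inter> frames)"
    and mU: "frame -` A \<inter> frames \<in> sets borel" if "A \<in> sets (restrict_space borel SO3)" for A
  proof -
    have s: "space U = frames" by (simp add: U_def space_restrict_space)
    show "emeasure \<nu> A = emeasure lborel (frame -` A \<inter> frames)"
      unfolding \<nu>_def using that fm F
      by (simp add: emeasure_distr s) (simp add: U_def emeasure_restrict_space)
    show "frame -` A \<inter> frames \<in> sets borel"
      using measurable_sets[OF fm that] F by (simp add: s) (auto simp: U_def sets_restrict_space_iff)
  qed
  have SO3_in: "SO3 \<in> sets (restrict_space borel SO3)"
    using sets.top[of "restrict_space borel SO3"] by (simp add: space_restrict_space)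
  define V where "V = emeasure \<nu> SO3"
  have V: "V = emeasure lborel frames"
    using eU[OF SO3_in] frame_in_SO3 by (simp add: V_def) (metis Int_absorb1 subsetI vimageI)
  have V0: "V \<noteq> 0"
  proof -
    have "((1/2) *\<^sub>R axis 1 1, (1/2) *\<^sub>R axis 2 1) \<in> frames"
      by (simp add: frames_def cross_mult_left cross_mult_right cross_basis)
    then have "frames \<noteq> {}" by blast
    then have "frames \<notin> null_sets lebesgue"
      using open_not_negligible[OF open_frames] by (simp add: negligible_iff_null_sets)
    then show ?thesis using V F by (simp add: null_sets_def)
  qed
  have Vfin: "V \<noteq> \<infinity>"
  proof -
    have "frames \<subseteq> ball 0 1 \<times> ball 0 1" by (auto simp: frames_def)
    then have "bounded frames" by (rule bounded_subset[rotated]) (intro bounded_Times bounded_ball)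
    then show ?thesis using V emeasure_bounded_finite[of frames] by auto
  qed
  define \<mu> where "\<mu> = scale_measure (inverse V) \<nu>"
  have sets: "sets \<mu> = sets (restrict_space borel SO3)" by (simp add: \<mu>_def \<nu>_def)
  have "emeasure \<mu> SO3 = 1"
    using V0 Vfin ennreal_divide_self[of V]
    by (simp add: \<mu>_def V_def[symmetric] divide_ennreal_def mult.commute top.not_eq_extremum)
  moreover have "emeasure \<mu> ((\<lambda>Q. R ** Q) ` A) = emeasure \<mu> A"
    if R: "R \<in> SO3" and A: "A \<in> sets \<mu>" for R A
  proof -
    let ?g = "\<lambda>(u, v). (R *v u, R *v v)"
    let ?B = "(\<lambda>Q. R ** Q) ` A"
    have oR: "transpose R ** R = mat 1" "R ** transpose R = mat 1"
      using R by (auto simp: SO3_def rotation_matrix_def orthogonal_matrix_def)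
    have inj: "R ** P = R ** Q \<Longrightarrow> P = Q" for P Q
      by (metis oR(1) matrix_mul_assoc matrix_mul_lid)
    have Asub: "A \<subseteq> SO3" using A sets by (auto simp: sets_restrict_space)
    have Beq: "?B = (\<lambda>Q. transpose R ** Q) -` A \<inter> SO3"
    proof (intro equalityI subsetI)
      fix X assume "X \<in> ?B"
      then obtain Q where Q: "X = R ** Q" "Q \<in> A" by blast
      then have "transpose R ** X \<in> A" by (simp add: matrix_mul_assoc oR)
      moreover have "X \<in> SO3" using R Q Asub
        by (auto simp: SO3_def rotation_matrix_def orthogonal_matrix_mul det_mul)
      ultimately show "X \<in> (\<lambda>Q. transpose R ** Q) -` A \<inter> SO3" by blast
    next
      fix X assume "X \<in> (\<lambda>Q. transpose R ** Q) -` A \<inter> SO3"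
      moreover have "X = R ** (transpose R ** X)" by (simp add: matrix_mul_assoc oR)
      ultimately show "X \<in> ?B" by blast
    qed
    have tm: "(\<lambda>Q. transpose R ** Q) \<in> measurable (restrict_space borel SO3) (restrict_space borel SO3)"
    proof (rule measurable_restrict_space3)
      show "(\<lambda>Q. transpose R ** Q) \<in> borel_measurable borel"
        unfolding matrix_matrix_mult_def by (intro borel_measurable_continuous_onI continuous_intros)
      show "(\<lambda>Q. transpose R ** Q) \<in> SO3 \<rightarrow> SO3" using R
        by (auto simp: SO3_def rotation_matrix_def orthogonal_matrix_mul orthogonal_matrix_transpose det_mul)
    qed
    have B: "?B \<in> sets (restrict_space borel SO3)"
      unfolding Beq using measurable_sets[OF tm] A sets by (simp add: space_restrict_space)
    have gm: "?g \<in> borel_measurable borel"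
      unfolding case_prod_unfold 
      by (intro borel_measurable_continuous_onI continuous_on_Pair
          continuous_on_compose2[OF matrix_vector_mult_linear_continuous_on[of UNIV]] continuous_intros) auto
    have "emeasure \<nu> ?B = emeasure (distr lborel borel ?g) (frame -` ?B \<inter> frames)"
      by (simp add: eU[OF B] distr_lborel_rotation2[OF R])
    also have "\<dots> = emeasure lborel (?g -` (frame -` ?B \<inter> frames))"
      using gm mU[OF B] by (simp add: emeasure_distr)
    also have "?g -` (frame -` ?B \<inter> frames) = frame -` A \<inter> frames"
    proof -
      have "R ** P \<in> ?B \<longleftrightarrow> P \<in> A" for P using inj by blast
      then have "?g x \<in> frame -` ?B \<inter> frames \<longleftrightarrow> x \<in> frame -` A \<inter> frames" for x
        by (cases x) (simp only: vimage_eq Int_iff case_prod_conv frame_rotate[OF R] frames_rotate[OF R])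
      then show ?thesis by blast
    qed
    also have "emeasure lborel \<dots> = emeasure \<nu> A" using eU A sets by simp
    finally show ?thesis by (simp add: \<mu>_def)
  qed
  ultimately have "haar_SO3 \<mu>" using sets by (auto simp: haar_SO3_def)
  then show ?thesis by blast
qed

end

theory Submission
  imports Defs
begin

text \<open>At an output consensus the edges $(1,2)$, $(1,3)$, $(2,3)$ carry unit vectors whose pairwise
  inner products are prescribed: $E_{12}y_{12}\cdot E_{13}y_{13}$ at agent 1,
  $E_{21}y_{12}\cdot E_{23}y_{23}$ at agent 2 and $E_{31}y_{13}\cdot E_{32}y_{23}$ at agent 3.
  Hence consensus forces the Gram determinant $G(E)$ of these numbers to be nonnegative, being the
  square of a triple product; conversely, if $G(E) > 0$, one may take $Q_1 = I$, solve for the third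
  vector explicitly and rotate the other two agents into place.

  If the reference vectors are coplanar, $G$ vanishes at the identity but has nonzero derivative along
  rotations of $E_{12}$ in the common plane. So arbitrarily close to the identity $G$ is negative on
  an open set (no consensus), and $G > k\varepsilon$ on another one; since the triple product vanishes
  on the state consensus set and is Lipschitz, the latter puts the two sets at distance of order
  $\sqrt{\varepsilon}$. If the vectors are independent, $G > 0$ near the identity, and the explicit
  solution depends differentiably on the six perturbed vectors, so it is within $O(\varepsilon)$
  of $(I, I, I)$.\<close>

subsection \<open>Rotations and the Frobenius norm\<close>

lemma SO3_one: "mat 1 \<in> SO3"
  by (simp add: SO3_def rotation_matrix_def orthogonal_matrix_id)

lemma SO3_inverse:
  assumes "Q \<in> SO3"
  shows "transpose Q ** Q = mat 1" "Q ** transpose Q = mat 1"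
    "transpose Q *v (Q *v x) = x" "Q *v (transpose Q *v x) = x"
proof -
  show 1: "transpose Q ** Q = mat 1" "Q ** transpose Q = mat 1"
    using assms by (auto simp: SO3_def rotation_matrix_def orthogonal_matrix_def)
  show "transpose Q *v (Q *v x) = x" "Q *v (transpose Q *v x) = x"
    by (simp_all only: matrix_vector_mul_assoc 1 matrix_vector_mul_lid)
qed

lemma SO3_inner: "Q \<in> SO3 \<Longrightarrow> (Q *v x) \<bullet> (Q *v y) = x \<bullet> y"
  by (metis SO3_orthogonal_transformation orthogonal_transformation_def)

lemma SO3_norm: "Q \<in> SO3 \<Longrightarrow> norm (Q *v x) = norm x"
  by (simp add: norm_eq_sqrt_inner SO3_inner)

lemma frob_norm_eq_norm: "frob_norm M = norm M"
  by (simp add: frob_norm_def norm_vec_def L2_set_def trace_def transpose_def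
      matrix_matrix_mult_def sum_3 power2_eq_square sum_nonneg algebra_simps)

lemma norm_transpose_mat3: "norm (transpose M) = norm M" for M :: mat3
  by (simp add: frob_norm_eq_norm[symmetric] frob_norm_def transpose_transpose trace_mul_sym[of M "transpose M"])

lemma frob_norm_mult_SO3:
  assumes "R \<in> SO3"
  shows "frob_norm (R ** X) = frob_norm X" "frob_norm (X ** R) = frob_norm X"
proof -
  have *: "frob_norm (R ** X) = frob_norm X" if "R \<in> SO3" for R X
  proof -
    have "transpose (R ** X) ** (R ** X) = transpose X ** (transpose R ** R) ** X"
      by (simp add: matrix_transpose_mul matrix_mul_assoc)
    then show ?thesis using SO3_inverse(1)[OF that] by (simp add: frob_norm_def)
  qed
  show "frob_norm (R ** X) = frob_norm X" by (rule *[OF assms])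
  show "frob_norm (X ** R) = frob_norm X"
    by (metis * SO3_transpose[OF assms] matrix_transpose_mul norm_transpose_mat3 frob_norm_eq_norm)
qed

lemma norm_matrix_vector_mult_le: "norm (M *v x) \<le> norm M * norm x" for M :: mat3
proof -
  have "norm (M *v x) \<le> L2_set (\<lambda>i. norm (M $ i) * norm x) UNIV"
    unfolding norm_vec_def[of "M *v x"]
    by (intro L2_set_mono) (simp_all add: matrix_vector_mul_component Cauchy_Schwarz_ineq2)
  also have "\<dots> = norm M * norm x"
    by (simp add: norm_vec_def[of M] L2_set_left_distrib)
  finally show ?thesis .
qed

lemma matrix_diff_rdistrib: "(A - B) ** C = A ** C - B ** C" for A B C :: mat3
  by (simp add: vec_eq_iff matrix_matrix_mult_def sum_3 algebra_simps)

definition rotation_between :: "vec3 \<Rightarrow> vec3 \<Rightarrow> vec3 \<Rightarrow> vec3 \<Rightarrow> mat3" where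
  "rotation_between u v u' v' = frame (u', v') ** transpose (frame (u, v))"

lemma norm_cross_unit: "norm u = 1 \<Longrightarrow> norm v = 1 \<Longrightarrow> (norm (cross3 u v))\<^sup>2 = 1 - (u \<bullet> v)\<^sup>2"
  using norm_cross_dot[of u v] by simp

lemma cross_unit_nonzero:
  "norm u = 1 \<Longrightarrow> norm v = 1 \<Longrightarrow> cross3 u v \<noteq> 0 \<longleftrightarrow> (u \<bullet> v)\<^sup>2 < 1"
  using norm_cross_unit[of u v] by (auto simp: power2_less_eq_zero_iff less_le) (smt (verit) zero_le_power2)

lemma frame_in_SO3_unit:
  assumes "norm u = 1" "norm v = 1" "cross3 u v \<noteq> 0"
  shows "frame (u, v) \<in> SO3"
proof -
  have "frame (u, v) = frame ((1/2) *\<^sub>R u, (1/2) *\<^sub>R v)"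
    using assms by (simp add: frame_def Let_def cross_mult_left cross_mult_right inverse_eq_divide)
  also have "\<dots> \<in> SO3"
    using assms by (intro frame_in_SO3) (simp add: frames_def cross_mult_left cross_mult_right)
  finally show ?thesis .
qed

lemma frame_coordinates:
  assumes "norm u = 1" "norm v = 1" "cross3 u v \<noteq> 0"
  shows "transpose (frame (u, v)) *v u = vector [1, 0, 0]"
    and "transpose (frame (u, v)) *v v = vector [u \<bullet> v, sqrt (1 - (u \<bullet> v)\<^sup>2), 0]"
proof -
  define n where "n = cross3 u v"
  have n: "norm n = sqrt (1 - (u \<bullet> v)\<^sup>2)" "n \<bullet> n = (norm n)\<^sup>2"
    by (simp_all add: n_def norm_cross_unit[OF assms(1,2), symmetric] power2_norm_eq_inner norm_eq_sqrt_inner)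
  have "norm n \<noteq> 0" using assms by (simp add: n_def)
  have T: "transpose (frame (u, v)) *v x = vector [u \<bullet> x, (cross3 n u \<bullet> x) / norm n, (n \<bullet> x) / norm n]" for x
    using assms
    by (simp add: frame_def Let_def transpose_transpose vec_eq_iff forall_3 matrix_vector_mul_component
        n_def cross_mult_left divide_inverse_commute)
  have "cross3 n u \<bullet> v = n \<bullet> n" by (simp add: n_def cross3_simps)
  then have 1: "cross3 n u \<bullet> v / norm n = norm n" using n(2) by (simp add: power2_eq_square)
  show "transpose (frame (u, v)) *v u = vector [1, 0, 0]"
    using assms(1) unfolding T by (simp add: dot_cross_self n_def flip: power2_norm_eq_inner)
  show "transpose (frame (u, v)) *v v = vector [u \<bullet> v, sqrt (1 - (u \<bullet> v)\<^sup>2), 0]"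
    unfolding T 1 n(1)[symmetric] by (simp add: n_def dot_cross_self)
qed

lemma rotation_between:
  assumes "norm u = 1" "norm v = 1" "cross3 u v \<noteq> 0"
    and "norm u' = 1" "norm v' = 1" "u' \<bullet> v' = u \<bullet> v"
  shows "rotation_between u v u' v' \<in> SO3"
    and "rotation_between u v u' v' *v u = u'"
    and "rotation_between u v u' v' *v v = v'"
    and "frob_norm (rotation_between u v u' v' - mat 1) = frob_norm (frame (u', v') - frame (u, v))"
proof -
  have c: "cross3 u' v' \<noteq> 0" using assms by (metis cross_unit_nonzero)
  note F = frame_in_SO3_unit[OF assms(1-3)] and F' = frame_in_SO3_unit[OF assms(4,5) c]
  show "rotation_between u v u' v' \<in> SO3"
    unfolding rotation_between_def by (intro SO3_mult SO3_transpose F F')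
  show "rotation_between u v u' v' *v u = u'" "rotation_between u v u' v' *v v = v'"
    using frame_coordinates[OF assms(1-3)] frame_coordinates[OF assms(4,5) c] assms(6) SO3_inverse(4)[OF F']
    unfolding rotation_between_def matrix_vector_mul_assoc[symmetric] by metis+
  have "rotation_between u v u' v' - mat 1 = (frame (u', v') - frame (u, v)) ** transpose (frame (u, v))"
    using SO3_inverse(2)[OF F]
    by (simp add: rotation_between_def matrix_diff_rdistrib)
  then show "frob_norm (rotation_between u v u' v' - mat 1) = frob_norm (frame (u', v') - frame (u, v))"
    by (simp add: frob_norm_mult_SO3 SO3_transpose F)
qed

subsection \<open>Haar measure of open sets\<close>

lemma haar_SO3_space: "haar_SO3 \<mu> \<Longrightarrow> space \<mu> = SO3"
  by (metis haar_SO3_def sets_eq_imp_space_eq space_restrict_space Int_UNIV_right space_borel)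

lemma haar_SO3_open_sets:
  assumes "haar_SO3 \<mu>" "open U"
  shows "SO3 \<inter> U \<in> sets \<mu>"
  using assms by (auto simp: haar_SO3_def sets_restrict_space)

lemma haar_SO3_open_pos:
  assumes \<mu>: "haar_SO3 \<mu>" and U: "open U" and Q: "Q \<in> SO3 \<inter> U"
  shows "emeasure \<mu> (SO3 \<inter> U) \<noteq> 0"
proof
  assume 0: "emeasure \<mu> (SO3 \<inter> U) = 0"
  let ?V = "\<lambda>R. (\<lambda>X. transpose R ** X) -` U"
  have op: "open (?V R)" for R
    by (rule open_vimage[OF U]) (unfold matrix_matrix_mult_def, intro continuous_intros)
  have "SO3 \<subseteq> (\<Union>R\<in>SO3. ?V R)"
  proof
    fix X assume X: "X \<in> SO3"
    have "transpose (X ** transpose Q) ** X = Q"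
      using SO3_inverse(1)[OF X] by (metis matrix_mul_assoc matrix_mul_rid matrix_transpose_mul transpose_transpose)
    moreover have "X ** transpose Q \<in> SO3" using X Q by (auto intro: SO3_mult SO3_transpose)
    ultimately show "X \<in> (\<Union>R\<in>SO3. ?V R)" using Q by (intro UN_I[of "X ** transpose Q"]) auto
  qed
  then obtain T where T: "T \<subseteq> SO3" "finite T" "SO3 \<subseteq> (\<Union>R\<in>T. ?V R)"
    by (rule compactE_image[OF compact_SO3 op])
  have eq: "(\<lambda>X. R ** X) ` (SO3 \<inter> U) = SO3 \<inter> ?V R" if "R \<in> SO3" for R
  proof (intro equalityI subsetI)
    fix X assume "X \<in> SO3 \<inter> ?V R"
    moreover have "X = R ** (transpose R ** X)"
      using SO3_inverse[OF that] by (simp add: matrix_mul_assoc)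
    ultimately show "X \<in> (\<lambda>X. R ** X) ` (SO3 \<inter> U)"
      using that by (auto intro!: image_eqI[of _ _ "transpose R ** X"] SO3_mult SO3_transpose)
  qed (use that SO3_inverse[OF that] in \<open>auto simp: matrix_mul_assoc intro: SO3_mult\<close>)
  have "SO3 \<inter> ?V R \<in> null_sets \<mu>" if "R \<in> T" for R
  proof -
    have "R \<in> SO3" using T that by auto
    then have "emeasure \<mu> (SO3 \<inter> ?V R) = emeasure \<mu> (SO3 \<inter> U)"
      using \<mu> haar_SO3_open_sets[OF \<mu> U] unfolding haar_SO3_def eq[symmetric, OF \<open>R \<in> SO3\<close>] by blast
    then show ?thesis using 0 haar_SO3_open_sets[OF \<mu> op] by auto
  qed
  then have "(\<Union>R\<in>T. SO3 \<inter> ?V R) \<in> null_sets \<mu>" using T(2) by (intro null_sets.finite_UN) auto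
  moreover have "(\<Union>R\<in>T. SO3 \<inter> ?V R) = SO3" using T(3) by auto
  ultimately show False using \<mu> by (auto simp: haar_SO3_def)
qed

lemma finite_arcs: "finite arcs"
  by (rule finite_subset[of _ "agents \<times> agents"]) (auto simp: arcs_def agents_def)

lemma open_perturbations_pos:
  assumes \<mu>: "haar_SO3 \<mu>" and W: "open W" and E: "E \<in> W" "E \<in> perturbations"
  obtains S where "S \<in> sets (\<Pi>\<^sub>M a\<in>arcs. \<mu>)" "S \<subseteq> W \<inter> perturbations"
    "emeasure (\<Pi>\<^sub>M a\<in>arcs. \<mu>) S \<noteq> 0"
proof -
  have "openin (product_topology (\<lambda>i. euclidean) UNIV) W" using W by (simp add: open_fun_def)
  from product_topology_open_contains_basis[OF this E(1)] obtain X where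
    X: "E \<in> (\<Pi>\<^sub>E i\<in>UNIV. X i)" "\<And>i. open (X i)" "(\<Pi>\<^sub>E i\<in>UNIV. X i) \<subseteq> W" by auto
  let ?S = "\<Pi>\<^sub>E a\<in>arcs. SO3 \<inter> X a"
  have m: "SO3 \<inter> X a \<in> sets \<mu>" for a by (rule haar_SO3_open_sets[OF \<mu> X(2)])
  interpret finite_measure \<mu>
    using \<mu> haar_SO3_space[OF \<mu>] by (intro finite_measureI) (simp add: haar_SO3_def)
  interpret product_sigma_finite "\<lambda>_. \<mu>" by standard
  have "?S \<in> sets (\<Pi>\<^sub>M a\<in>arcs. \<mu>)" by (intro sets_PiM_I_finite finite_arcs m)
  moreover have "F \<in> W \<inter> perturbations" if F: "F \<in> ?S" for F
  proof -
    have "F a \<in> X a" for a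
    proof (cases "a \<in> arcs")
      case False
      then have "F a = E a" using F E(2) by (auto simp: perturbations_def intro: PiE_arb[THEN trans, OF _ _ PiE_arb[symmetric]])
      then show ?thesis using X(1) by auto
    qed (use F in auto)
    then show ?thesis using X(3) F by (auto simp: perturbations_def)
  qed
  moreover have "emeasure (\<Pi>\<^sub>M a\<in>arcs. \<mu>) ?S \<noteq> 0"
  proof -
    have "emeasure (\<Pi>\<^sub>M a\<in>arcs. \<mu>) ?S = (\<Prod>a\<in>arcs. emeasure \<mu> (SO3 \<inter> X a))"
      by (intro emeasure_PiM finite_arcs m)
    moreover have "emeasure \<mu> (SO3 \<inter> X a) \<noteq> 0" if "a \<in> arcs" for a
      using X(1) E(2) that by (intro haar_SO3_open_pos[OF \<mu> X(2), of "E a"]) (auto simp: perturbations_def)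
    ultimately show ?thesis using finite_arcs by simp
  qed
  ultimately show ?thesis using that by blast
qed

lemma rank_of3_eq_3_iff: "rank_of3 a b c = 3 \<longleftrightarrow> a \<bullet> cross3 b c \<noteq> 0"
proof -
  let ?M = "vector [a, b, c] :: mat3"
  have "rank ?M \<le> 3" using rank_bound[of ?M] by simp
  then show ?thesis
    using det_eq_0_rank[of ?M] by (auto simp: rank_of3_def rank_transpose dot_cross_det)
qed

lemma rank_of2_eq_2_cross:
  assumes "rank_of2 a b = 2"
  shows "cross3 a b \<noteq> 0"
proof
  assume "cross3 a b = 0"
  then have "collinear {0, a, b}" by (simp add: cross_eq_0)
  then obtain c where "\<And>x y. x \<in> {0, a, b} \<Longrightarrow> y \<in> {0, a, b} \<Longrightarrow> \<exists>k. x - y = k *\<^sub>R c"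
    unfolding collinear_def by blast
  from this[of a 0] this[of b 0] have c: "{a, b} \<subseteq> span {c}"
    by (auto simp: span_singleton)
  have "rows (vector [a, b] :: real^3^2) \<subseteq> {a, b}"
  proof
    fix x assume "x \<in> rows (vector [a, b] :: real^3^2)"
    then obtain i :: 2 where "x = (vector [a, b] :: real^3^2) $ i"
      by (auto simp: rows_def row_def vec_lambda_eta)
    then show "x \<in> {a, b}" using exhaust_2[of i] by auto
  qed
  then have "dim (rows (vector [a, b] :: real^3^2)) \<le> dim (span {c})"
    using c by (intro dim_subset) auto
  also have "\<dots> \<le> 1" using dim_le_card[of "span {c}" "{c}"] by auto
  finally have "rank (vector [a, b] :: real^3^2) \<le> 1" by (simp only: row_rank_def)
  with assms show False by (simp only: rank_of2_def rank_transpose)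
qed

subsection \<open>Unit vectors with prescribed inner products\<close>

definition gram :: "real \<Rightarrow> real \<Rightarrow> real \<Rightarrow> real" where
  "gram a b c = 1 + 2 * a * b * c - a\<^sup>2 - b\<^sup>2 - c\<^sup>2"

lemma triple_product_sq:
  assumes "norm u = 1" "norm v = 1" "norm w = 1"
  shows "(u \<bullet> cross3 v w)\<^sup>2 = gram (u \<bullet> v) (u \<bullet> w) (v \<bullet> w)"
proof -
  have "(u \<bullet> cross3 v w)\<^sup>2 = (u \<bullet> u) * (v \<bullet> v) * (w \<bullet> w) + 2 * (u \<bullet> v) * (u \<bullet> w) * (v \<bullet> w)
      - (u \<bullet> v)\<^sup>2 * (w \<bullet> w) - (u \<bullet> w)\<^sup>2 * (v \<bullet> v) - (v \<bullet> w)\<^sup>2 * (u \<bullet> u)"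
    unfolding cross3_def inner_vec_def sum_3 power2_eq_square
    by (simp, algebra)
  then show ?thesis using assms by (simp add: gram_def norm_eq_1)
qed

lemma triple_product_sq':
  assumes "norm u = 1" "norm v = 1" "norm w = 1"
  shows "(w \<bullet> cross3 u v)\<^sup>2 = gram (u \<bullet> v) (u \<bullet> w) (v \<bullet> w)"
  using triple_product_sq[OF assms(3,1,2)] by (simp add: gram_def inner_commute algebra_simps)

lemma gram_factor:
  "gram a b c = (1 - b\<^sup>2) * (1 - c\<^sup>2) - (a - b * c)\<^sup>2"
  "gram a b c = (1 - a\<^sup>2) * (1 - c\<^sup>2) - (b - a * c)\<^sup>2"
  "gram a b c = (1 - a\<^sup>2) * (1 - b\<^sup>2) - (c - a * b)\<^sup>2"
  by (simp_all add: gram_def power2_eq_square algebra_simps)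

lemma unit_inner_sq_le: "norm (u :: vec3) = 1 \<Longrightarrow> norm v = 1 \<Longrightarrow> (u \<bullet> v)\<^sup>2 \<le> 1"
  using norm_cross_unit[of u v] by (smt (verit) zero_le_power2)

lemma gram_pos_imp:
  assumes "gram a b c > 0" "a\<^sup>2 \<le> 1" "b\<^sup>2 \<le> 1" "c\<^sup>2 \<le> 1"
  shows "a\<^sup>2 < 1" "b\<^sup>2 < 1" "c\<^sup>2 < 1"
proof -
  have "a\<^sup>2 \<noteq> 1" using assms(1) unfolding gram_factor(2) by auto
  moreover have "b\<^sup>2 \<noteq> 1" "c\<^sup>2 \<noteq> 1" using assms(1) unfolding gram_factor(1) by auto
  ultimately show "a\<^sup>2 < 1" "b\<^sup>2 < 1" "c\<^sup>2 < 1" using assms by (auto simp: less_le)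
qed

text \<open>The vector with inner products \<open>b\<close> and \<open>c\<close> with the unit vectors \<open>u\<close> and \<open>v\<close>; its
  component along the normal is fixed by unit length up to the sign \<open>s\<close>.\<close>

definition third :: "real \<Rightarrow> vec3 \<Rightarrow> vec3 \<Rightarrow> real \<Rightarrow> real \<Rightarrow> vec3" where
  "third s u v b c = ((b - (u \<bullet> v) * c) / (1 - (u \<bullet> v)\<^sup>2)) *\<^sub>R u + ((c - (u \<bullet> v) * b) / (1 - (u \<bullet> v)\<^sup>2)) *\<^sub>R v
     + (s * sqrt (gram (u \<bullet> v) b c) / (1 - (u \<bullet> v)\<^sup>2)) *\<^sub>R cross3 u v"

lemma third_inner:
  assumes u: "norm u = 1" and v: "norm v = 1" and uv: "(u \<bullet> v)\<^sup>2 < 1"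
  shows "u \<bullet> third s u v b c = b" "v \<bullet> third s u v b c = c"
    "cross3 u v \<bullet> third s u v b c = s * sqrt (gram (u \<bullet> v) b c)"
proof -
  have n: "cross3 u v \<bullet> cross3 u v = 1 - (u \<bullet> v)\<^sup>2"
    using norm_cross_unit[OF u v] by (simp add: power2_norm_eq_inner)
  have 1: "u \<bullet> u = 1" "v \<bullet> v = 1" "v \<bullet> u = u \<bullet> v"
    using u v by (simp_all add: norm_eq_1 inner_commute)
  have d: "1 - (u \<bullet> v)\<^sup>2 \<noteq> 0" using uv by simp
  have solve: "(x - a * z) / (1 - a\<^sup>2) + (z - a * x) / (1 - a\<^sup>2) * a = x" if "1 - a\<^sup>2 \<noteq> 0" for a x z :: real
    using that by (simp add: divide_simps) (simp add: algebra_simps power2_eq_square)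
  show "u \<bullet> third s u v b c = b" "v \<bullet> third s u v b c = c"
    using solve[OF d, of b c] solve[OF d, of c b]
    by (simp_all add: third_def inner_add_right 1 dot_cross_self)
  show "cross3 u v \<bullet> third s u v b c = s * sqrt (gram (u \<bullet> v) b c)"
    using d by (simp add: third_def inner_add_right n dot_cross_self)
qed

lemma norm_third:
  assumes "norm u = 1" "norm v = 1" "(u \<bullet> v)\<^sup>2 < 1" "s\<^sup>2 = 1" "gram (u \<bullet> v) b c \<ge> 0"
  shows "norm (third s u v b c) = 1"
proof -
  let ?w = "third s u v b c" and ?d = "1 - (u \<bullet> v)\<^sup>2"
  have "?w \<bullet> ?w = ((b - (u \<bullet> v) * c) / ?d) * (u \<bullet> ?w) + ((c - (u \<bullet> v) * b) / ?d) * (v \<bullet> ?w)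
     + (s * sqrt (gram (u \<bullet> v) b c) / ?d) * (cross3 u v \<bullet> ?w)"
    by (subst (1) third_def) (simp only: inner_add_left inner_scaleR_left)
  also have "\<dots> = ((b - (u \<bullet> v) * c) * b + (c - (u \<bullet> v) * b) * c + s\<^sup>2 * (sqrt (gram (u \<bullet> v) b c))\<^sup>2) / ?d"
    unfolding third_inner[OF assms(1-3)] by (simp add: power2_eq_square add_divide_distrib)
  also have "\<dots> = ?d / ?d"
    using assms(4,5) by (simp add: gram_def power2_eq_square algebra_simps)
  also have "\<dots> = 1" using assms(3) by simp
  finally show ?thesis by (simp add: norm_eq_1)
qed

lemma third_self:
  assumes "norm u = 1" "norm v = 1" "norm w = 1" "(u \<bullet> v)\<^sup>2 < 1"
  shows "third (sgn (w \<bullet> cross3 u v)) u v (u \<bullet> w) (v \<bullet> w) = w"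
proof -
  let ?x = "third (sgn (w \<bullet> cross3 u v)) u v (u \<bullet> w) (v \<bullet> w) - w"
  have "sqrt (gram (u \<bullet> v) (u \<bullet> w) (v \<bullet> w)) = \<bar>w \<bullet> cross3 u v\<bar>"
    using triple_product_sq'[OF assms(1-3)] by (metis real_sqrt_abs)
  then have "cross3 u v \<bullet> ?x = 0"
    by (simp add: inner_diff_right third_inner[OF assms(1,2,4)] sgn_mult_abs inner_commute[of "cross3 u v" w])
  then have "?x \<bullet> u = 0" "?x \<bullet> v = 0" "?x \<bullet> cross3 u v = 0"
    by (simp_all only: inner_commute[of ?x] inner_diff_right third_inner[OF assms(1,2,4)] diff_self)
  moreover have "cross3 ?x (cross3 u v) = 0"
    using calculation(1,2) by (simp add: Lagrange)
  ultimately have "?x = 0" 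
    using norm_and_cross_eq_0[of ?x "cross3 u v"] cross_unit_nonzero[OF assms(1,2)] assms(4) by auto
  then show ?thesis by simp
qed

subsection \<open>Differentiability\<close>

lemma differentiable_cross [derivative_intros]:
  assumes "f differentiable (at x within S)" "g differentiable (at x within S)"
  shows "(\<lambda>x. cross3 (f x) (g x)) differentiable (at x within S)"
proof -
  have *: "bounded_bilinear cross3"
    using bilinear_cross by (simp add: bilinear_conv_bounded_bilinear)
  show ?thesis
    using assms unfolding differentiable_def by (blast intro: bounded_bilinear.FDERIV[OF *])
qed

lemma differentiable_vec_components:
  fixes f :: "'p::real_normed_vector \<Rightarrow> 'b::euclidean_space ^ 'n"
  assumes "\<And>i. (\<lambda>x. f x $ i) differentiable (at p)"
  shows "f differentiable (at p)"
proof (subst differentiable_componentwise_within, safe)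
  fix i :: "'b ^ 'n" assume "i \<in> Basis"
  then obtain j u where "i = axis j u" by (auto simp: Basis_vec_def)
  then show "(\<lambda>x. f x \<bullet> i) differentiable (at p)"
    using differentiable_inner[OF assms[of j] differentiable_const[of u]] by (simp add: inner_axis)
qed

lemma differentiable_vec_nth [derivative_intros]:
  assumes "f differentiable F"
  shows "(\<lambda>x. f x $ i) differentiable F"
  using assms bounded_linear.has_derivative[OF bounded_linear_vec_nth[of i]]
  unfolding differentiable_def by blast

lemma differentiable_normalize:
  fixes f :: "'p::real_normed_vector \<Rightarrow> vec3"
  assumes "f differentiable (at p)" "f p \<noteq> 0"
  shows "(\<lambda>x. f x /\<^sub>R norm (f x)) differentiable (at p)"
proof -
  have "(\<lambda>x. norm (f x)) differentiable (at p)"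
    using differentiable_compose[of norm f p UNIV] assms
    by (auto intro: differentiable_subset)
  then show ?thesis using assms by (intro derivative_intros) auto
qed

lemma differentiable_frame:
  fixes f g :: "'p::real_normed_vector \<Rightarrow> vec3"
  assumes f: "f differentiable (at p)" and g: "g differentiable (at p)"
    and nz: "cross3 (f p) (g p) \<noteq> 0"
  shows "(\<lambda>x. frame (f x, g x)) differentiable (at p)"
proof -
  have "f p \<noteq> 0" using nz by auto
  note a = differentiable_normalize[OF f this]
  note c = differentiable_normalize[OF differentiable_cross[OF f g] nz]
  note b = differentiable_cross[OF c a]
  have "(\<lambda>x. frame (f x, g x) $ i $ j) differentiable (at p)" for i j
    using exhaust_3[of j] differentiable_vec_nth[OF a, of i] differentiable_vec_nth[OF b, of i]
      differentiable_vec_nth[OF c, of i]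
    by (auto simp: frame_def Let_def transpose_def)
  then show ?thesis by (intro differentiable_vec_components)
qed

lemma differentiable_sqrt:
  fixes f :: "'p::real_normed_vector \<Rightarrow> real"
  assumes "f differentiable (at p)" "f p > 0"
  shows "(\<lambda>x. sqrt (f x)) differentiable (at p)"
proof -
  have "sqrt differentiable (at (f p))"
    using DERIV_real_sqrt[OF assms(2)] real_differentiable_def by blast
  then show ?thesis
    using assms(1) differentiable_compose[of sqrt f p UNIV] by (auto intro: differentiable_subset)
qed

lemma differentiable_third:
  fixes f g :: "'p::real_normed_vector \<Rightarrow> vec3" and b c :: "'p \<Rightarrow> real"
  assumes "f differentiable (at p)" "g differentiable (at p)" "b differentiable (at p)" "c differentiable (at p)"
    and "(f p \<bullet> g p)\<^sup>2 < 1" "gram (f p \<bullet> g p) (b p) (c p) > 0"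
  shows "(\<lambda>x. third s (f x) (g x) (b x) (c x)) differentiable (at p)"
proof -
  have i: "(\<lambda>x. f x \<bullet> g x) differentiable (at p)" using assms by (intro differentiable_inner)
  have "(\<lambda>x. gram (f x \<bullet> g x) (b x) (c x)) differentiable (at p)"
    unfolding gram_def using assms i by (intro derivative_intros)
  note s = differentiable_sqrt[OF this assms(6)]
  show ?thesis unfolding third_def
    using assms i s by (intro derivative_intros) auto
qed

lemma differentiable_imp_Lipschitz_at:
  fixes f :: "'a::real_normed_vector \<Rightarrow> 'b::real_normed_vector"
  assumes "f differentiable (at p)"
  obtains L d where "d > 0" "L > 0" "\<And>x. norm (x - p) < d \<Longrightarrow> norm (f x - f p) \<le> L * norm (x - p)"
proof -
  obtain f' where f': "(f has_derivative f') (at p)" using assms by (auto simp: differentiable_def)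
  then have "bounded_linear f'" by (rule has_derivative_bounded_linear)
  then obtain K where K: "K > 0" "\<And>x. norm (f' x) \<le> norm x * K"
    using bounded_linear.pos_bounded by blast
  obtain d where d: "d > 0" "\<And>x. norm (x - p) < d \<Longrightarrow> norm (f x - f p - f' (x - p)) \<le> 1 * norm (x - p)"
    using f' zero_less_one unfolding has_derivative_at_alt by blast
  show ?thesis
  proof
    fix x assume x: "norm (x - p) < d"
    have "norm (f x - f p) \<le> norm (f x - f p - f' (x - p)) + norm (f' (x - p))"
      by (metis diff_add_cancel norm_triangle_ineq)
    also have "\<dots> \<le> (1 + K) * norm (x - p)"
      using d(2)[OF x] K(2)[of "x - p"] by (simp add: algebra_simps)
    finally show "norm (f x - f p) \<le> (1 + K) * norm (x - p)" .
  qed (use d K in auto)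
qed

subsection \<open>Aligning the outputs\<close>

lemma aligning_rotations:
  fixes a12 a13 a21 a23 a31 a32 :: vec3 and s :: real
  assumes unit: "norm a12 = 1" "norm a13 = 1" "norm a21 = 1" "norm a23 = 1" "norm a31 = 1" "norm a32 = 1"
    and s: "s\<^sup>2 = 1" and pos: "gram (a12 \<bullet> a13) (a21 \<bullet> a23) (a31 \<bullet> a32) > 0"
  defines "w \<equiv> third s a12 a13 (a21 \<bullet> a23) (a31 \<bullet> a32)"
  obtains Q2 Q3 where "Q2 \<in> SO3" "Q3 \<in> SO3"
    "Q2 *v a12 = a21" "Q2 *v w = a23" "Q3 *v a13 = a31" "Q3 *v w = a32"
    "frob_norm (Q2 - mat 1) = frob_norm (frame (a21, a23) - frame (a12, w))"
    "frob_norm (Q3 - mat 1) = frob_norm (frame (a31, a32) - frame (a13, w))"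
proof -
  note lt = gram_pos_imp[OF pos unit_inner_sq_le[OF unit(1,2)] unit_inner_sq_le[OF unit(3,4)]
      unit_inner_sq_le[OF unit(5,6)]]
  have w: "norm w = 1"
    unfolding w_def using pos by (intro norm_third unit lt s) simp
  have i: "a12 \<bullet> w = a21 \<bullet> a23" "a13 \<bullet> w = a31 \<bullet> a32"
    unfolding w_def by (rule third_inner[OF unit(1,2) lt(1)])+
  have c: "cross3 a12 w \<noteq> 0" "cross3 a13 w \<noteq> 0"
    using cross_unit_nonzero[OF unit(1) w] cross_unit_nonzero[OF unit(2) w] i lt by simp_all
  show ?thesis
    using that rotation_between[OF unit(1) w c(1) unit(3,4) i(1)[symmetric]]
      rotation_between[OF unit(2) w c(2) unit(5,6) i(2)[symmetric]] by blast
qed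

lemma aligning_rotations_near:
  fixes u v w :: vec3
  assumes unit: "norm u = 1" "norm v = 1" "norm w = 1" and vol: "w \<bullet> cross3 u v \<noteq> 0"
  obtains L d where "L > 0" "d > 0"
    "\<And>a12 a13 a21 a23 a31 a32 e. \<lbrakk>norm a12 = 1; norm a13 = 1; norm a21 = 1; norm a23 = 1; norm a31 = 1; norm a32 = 1;
       norm (a12 - u) \<le> e; norm (a13 - v) \<le> e; norm (a21 - u) \<le> e; norm (a23 - w) \<le> e;
       norm (a31 - v) \<le> e; norm (a32 - w) \<le> e; e < d\<rbrakk> \<Longrightarrow>
       \<exists>Q2\<in>SO3. \<exists>Q3\<in>SO3. \<exists>x. Q2 *v a12 = a21 \<and> Q2 *v x = a23 \<and> Q3 *v a13 = a31 \<and> Q3 *v x = a32 \<and>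
         frob_norm (Q2 - mat 1) \<le> L * e \<and> frob_norm (Q3 - mat 1) \<le> L * e"
proof -
  define s where "s = sgn (w \<bullet> cross3 u v)"
  have s: "s\<^sup>2 = 1" using vol by (auto simp: s_def sgn_if)
  define b :: "(vec3 \<times> vec3) \<times> (vec3 \<times> vec3) \<times> (vec3 \<times> vec3) \<Rightarrow> real"
    where "b p = fst (fst (snd p)) \<bullet> snd (fst (snd p))" for p
  define c :: "(vec3 \<times> vec3) \<times> (vec3 \<times> vec3) \<times> (vec3 \<times> vec3) \<Rightarrow> real"
    where "c p = fst (snd (snd p)) \<bullet> snd (snd (snd p))" for p
  define g where "g p = gram (fst (fst p) \<bullet> snd (fst p)) (b p) (c p)" for p
  define t where "t p = third s (fst (fst p)) (snd (fst p)) (b p) (c p)" for p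
  define D2 where "D2 p = frame (fst (fst (snd p)), snd (fst (snd p))) - frame (fst (fst p), t p)" for p
  define D3 where "D3 p = frame (fst (snd (snd p)), snd (snd (snd p))) - frame (snd (fst p), t p)" for p
  let ?p = "((u, v), (u, w), (v, w))"
  have gp: "g ?p > 0"
    using vol by (simp add: g_def b_def c_def flip: triple_product_sq'[OF unit])
  have lt: "(u \<bullet> v)\<^sup>2 < 1" "(u \<bullet> w)\<^sup>2 < 1" "(v \<bullet> w)\<^sup>2 < 1"
    using gram_pos_imp[of "u \<bullet> v" "u \<bullet> w" "v \<bullet> w"] gp unit_inner_sq_le unit
    by (simp_all add: g_def b_def c_def)
  have tp: "t ?p = w"
    using third_self[OF unit lt(1)] by (simp add: t_def s_def b_def c_def)
  have fd: "(\<lambda>p. fst (f p)) differentiable (at ?p)" "(\<lambda>p. snd (f p)) differentiable (at ?p)"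
    if "f differentiable (at ?p)" for f :: "_ \<Rightarrow> 'x::real_normed_vector \<times> 'y::real_normed_vector"
    using that unfolding differentiable_def by (blast intro: has_derivative_fst has_derivative_snd)+
  note id = differentiable_ident[of "at ?p"]
  note fs = fd(1)[OF id] fd(2)[OF id]
  have dfs: "(\<lambda>p. fst (fst p)) differentiable (at ?p)" "(\<lambda>p. snd (fst p)) differentiable (at ?p)"
    "(\<lambda>p. fst (fst (snd p))) differentiable (at ?p)" "(\<lambda>p. snd (fst (snd p))) differentiable (at ?p)"
    "(\<lambda>p. fst (snd (snd p))) differentiable (at ?p)" "(\<lambda>p. snd (snd (snd p))) differentiable (at ?p)"
    by (intro fd fs)+
  have bc: "b differentiable (at ?p)" "c differentiable (at ?p)"
    unfolding b_def c_def by (intro differentiable_inner dfs)+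
  have t: "t differentiable (at ?p)"
    unfolding t_def using lt gp by (intro differentiable_third dfs bc) (simp_all add: g_def)
  have nz: "cross3 u w \<noteq> 0" "cross3 v w \<noteq> 0"
    using cross_unit_nonzero lt unit by blast+
  have "D2 differentiable (at ?p)" "D3 differentiable (at ?p)"
    unfolding D2_def D3_def
    by (intro differentiable_diff differentiable_frame dfs t; simp add: tp nz)+
  moreover have "D2 ?p = 0" "D3 ?p = 0" by (simp_all add: D2_def D3_def tp)
  ultimately obtain L2 d2 L3 d3 where
    L2: "d2 > 0" "L2 > 0" "\<And>p. norm (p - ?p) < d2 \<Longrightarrow> norm (D2 p) \<le> L2 * norm (p - ?p)" and
    L3: "d3 > 0" "L3 > 0" "\<And>p. norm (p - ?p) < d3 \<Longrightarrow> norm (D3 p) \<le> L3 * norm (p - ?p)"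
    by (metis (no_types, lifting) diff_zero differentiable_imp_Lipschitz_at)
  have "open {p. 0 < g p}"
    unfolding g_def b_def c_def gram_def
    by (intro open_Collect_less continuous_intros)
  with gp obtain d1 where "d1 > 0" "ball ?p d1 \<subseteq> {p. 0 < g p}"
    by (metis mem_Collect_eq open_contains_ball)
  then have d1: "d1 > 0" and "p \<in> ball ?p d1 \<Longrightarrow> g p > 0" for p
    by blast+
  then have d1': "norm (p - ?p) < d1 \<Longrightarrow> g p > 0" for p
    by (simp only: mem_ball dist_norm norm_minus_commute)
  define d where "d = min d1 (min d2 d3) / 6"
  define L where "L = 6 * max L2 L3"
  show ?thesis
  proof
    show "L > 0" "d > 0" using d1 L2 L3 by (auto simp: d_def L_def)
    fix a12 a13 a21 a23 a31 a32 :: vec3 and e :: real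
    assume un: "norm a12 = 1" "norm a13 = 1" "norm a21 = 1" "norm a23 = 1" "norm a31 = 1" "norm a32 = 1"
      and e: "norm (a12 - u) \<le> e" "norm (a13 - v) \<le> e" "norm (a21 - u) \<le> e" "norm (a23 - w) \<le> e"
       "norm (a31 - v) \<le> e" "norm (a32 - w) \<le> e" and ed: "e < d"
    let ?q = "((a12, a13), (a21, a23), (a31, a32))"
    have "norm (?q - ?p) \<le> norm (a12 - u, a13 - v) + (norm (a21 - u, a23 - w) + norm (a31 - v, a32 - w))"
      by (simp, meson add_left_mono norm_Pair_le order_trans)
    also have "\<dots> \<le> 6 * e"
      using norm_Pair_le[of "a12 - u" "a13 - v"] norm_Pair_le[of "a21 - u" "a23 - w"]
        norm_Pair_le[of "a31 - v" "a32 - w"] e by linarith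
    finally have q: "norm (?q - ?p) \<le> 6 * e" .
    then have q': "norm (?q - ?p) < d1" "norm (?q - ?p) < d2" "norm (?q - ?p) < d3"
      using ed by (auto simp: d_def)
    have "L2 * norm (?q - ?p) \<le> max L2 L3 * (6 * e)" "L3 * norm (?q - ?p) \<le> max L2 L3 * (6 * e)"
      using q L2(2) L3(2) by (intro mult_mono; simp)+
    then have D: "norm (D2 ?q) \<le> L * e" "norm (D3 ?q) \<le> L * e"
      using L2(3)[OF q'(2)] L3(3)[OF q'(3)] by (auto simp: L_def)
    have "gram (a12 \<bullet> a13) (a21 \<bullet> a23) (a31 \<bullet> a32) > 0"
      using d1'[OF q'(1)] by (simp add: g_def b_def c_def)
    from aligning_rotations[OF un s this] D
    show "\<exists>Q2\<in>SO3. \<exists>Q3\<in>SO3. \<exists>x. Q2 *v a12 = a21 \<and> Q2 *v x = a23 \<and> Q3 *v a13 = a31 \<and> Q3 *v x = a32 \<and>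
         frob_norm (Q2 - mat 1) \<le> L * e \<and> frob_norm (Q3 - mat 1) \<le> L * e"
      by (simp add: D2_def D3_def t_def b_def c_def frob_norm_eq_norm) metis
  qed
qed

lemma triple_product_Lipschitz:
  assumes "norm u = 1" "norm v = 1" "norm w = 1" "norm u' = 1" "norm v' = 1" "norm w' = 1"
    and "norm (u - u') \<le> e" "norm (v - v') \<le> e" "norm (w - w') \<le> e"
  shows "\<bar>u \<bullet> cross3 v w - u' \<bullet> cross3 v' w'\<bar> \<le> 3 * e"
proof -
  have "norm (cross3 x y) \<le> norm x * norm y" for x y
    using norm_cross_dot[of x y] zero_le_power2[of "x \<bullet> y"]
    by (intro power2_le_imp_le[of "norm (cross3 x y)"]) (linarith, simp)
  then have *: "\<bar>x \<bullet> cross3 y z\<bar> \<le> norm x * (norm y * norm z)" for x y z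
    by (meson Cauchy_Schwarz_ineq2 mult_left_mono norm_ge_zero order_trans)
  have "u \<bullet> cross3 v w - u' \<bullet> cross3 v' w' =
      (u - u') \<bullet> cross3 v w + u' \<bullet> cross3 (v - v') w + u' \<bullet> cross3 v' (w - w')"
    by (simp add: Cross3.left_diff_distrib Cross3.right_diff_distrib inner_diff_left inner_diff_right)
  then show ?thesis
    using *[of "u - u'" v w] *[of u' "v - v'" w] *[of u' v' "w - w'"] assms by simp
qed

subsection \<open>Output consensus of three agents\<close>

definition perturbed_gram :: "(nat \<times> nat \<Rightarrow> vec3) \<Rightarrow> (nat \<times> nat \<Rightarrow> mat3) \<Rightarrow> real" where
  "perturbed_gram y E = gram ((E (1,2) *v y (1,2)) \<bullet> (E (1,3) *v y (1,3)))
     ((E (2,1) *v y (1,2)) \<bullet> (E (2,3) *v y (2,3))) ((E (3,1) *v y (1,3)) \<bullet> (E (3,2) *v y (2,3)))"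

lemma output_consensus_iff:
  "Q \<in> output_consensus y E \<longleftrightarrow> Q \<in> configurations \<and>
     transpose (Q 1) *v (E (1,2) *v y (1,2)) = transpose (Q 2) *v (E (2,1) *v y (1,2)) \<and>
     transpose (Q 1) *v (E (1,3) *v y (1,3)) = transpose (Q 3) *v (E (3,1) *v y (1,3)) \<and>
     transpose (Q 2) *v (E (2,3) *v y (2,3)) = transpose (Q 3) *v (E (3,2) *v y (2,3))"
  by (auto simp: output_consensus_def edges_def)

lemma configurations_SO3: "Q \<in> configurations \<Longrightarrow> Q 1 \<in> SO3 \<and> Q 2 \<in> SO3 \<and> Q 3 \<in> SO3"
  by (auto simp: configurations_def agents_def)

lemma perturbations_SO3:
  "E \<in> perturbations \<Longrightarrow> E (1,2) \<in> SO3 \<and> E (1,3) \<in> SO3 \<and> E (2,1) \<in> SO3 \<and> E (2,3) \<in> SO3 \<and> E (3,1) \<in> SO3 \<and> E (3,2) \<in> SO3"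
  unfolding perturbations_def by (intro conjI PiE_mem[of E arcs]) (simp_all add: arcs_def agents_def)

lemma output_consensus_perturbed_gram:
  assumes "norm (y (1,2)) = 1" "norm (y (1,3)) = 1" "norm (y (2,3)) = 1"
    and E: "E \<in> perturbations" and Q: "Q \<in> output_consensus y E"
  shows "perturbed_gram y E = ((transpose (Q 1) *v (E (1,2) *v y (1,2))) \<bullet>
     cross3 (transpose (Q 1) *v (E (1,3) *v y (1,3))) (transpose (Q 2) *v (E (2,3) *v y (2,3))))\<^sup>2"
proof -
  note q = Q[unfolded output_consensus_iff]
  note eqs = q[THEN conjunct2, THEN conjunct1] q[THEN conjunct2, THEN conjunct2, THEN conjunct1]
    q[THEN conjunct2, THEN conjunct2, THEN conjunct2]
  have QS: "transpose (Q 1) \<in> SO3" "transpose (Q 2) \<in> SO3" "transpose (Q 3) \<in> SO3"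
    using q configurations_SO3 SO3_transpose by auto
  note ES = perturbations_SO3[OF E]
  let ?u = "transpose (Q 1) *v (E (1,2) *v y (1,2))" and ?v = "transpose (Q 1) *v (E (1,3) *v y (1,3))"
    and ?w = "transpose (Q 2) *v (E (2,3) *v y (2,3))"
  have "norm ?u = 1" "norm ?v = 1" "norm ?w = 1"
    using assms(1-3) QS ES by (simp_all only: SO3_norm)
  moreover have "?u \<bullet> ?v = (E (1,2) *v y (1,2)) \<bullet> (E (1,3) *v y (1,3))"
    by (rule SO3_inner[OF QS(1)])
  moreover have "?u \<bullet> ?w = (E (2,1) *v y (1,2)) \<bullet> (E (2,3) *v y (2,3))"
    by (simp only: eqs(1) SO3_inner[OF QS(2)])
  moreover have "?v \<bullet> ?w = (E (3,1) *v y (1,3)) \<bullet> (E (3,2) *v y (2,3))"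
    by (simp only: eqs(2,3) SO3_inner[OF QS(3)])
  ultimately show ?thesis
    using triple_product_sq[of ?u ?v ?w] by (simp only: perturbed_gram_def)
qed

lemma output_consensusI:
  assumes "Q2 \<in> SO3" "Q3 \<in> SO3"
    and "Q2 *v (E (1,2) *v y (1,2)) = E (2,1) *v y (1,2)" "Q2 *v x = E (2,3) *v y (2,3)"
    and "Q3 *v (E (1,3) *v y (1,3)) = E (3,1) *v y (1,3)" "Q3 *v x = E (3,2) *v y (2,3)"
  shows "(\<lambda>i\<in>agents. if i = 1 then mat 1 else if i = 2 then Q2 else Q3) \<in> output_consensus y E"
proof -
  have "(\<lambda>i\<in>agents. if i = 1 then mat 1 else if i = 2 then Q2 else Q3) \<in> configurations"
    using assms SO3_one by (auto simp: configurations_def)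
  moreover have "transpose Q2 *v (E (2,1) *v y (1,2)) = E (1,2) *v y (1,2)"
    "transpose Q3 *v (E (3,1) *v y (1,3)) = E (1,3) *v y (1,3)"
    "transpose Q2 *v (E (2,3) *v y (2,3)) = transpose Q3 *v (E (3,2) *v y (2,3))"
    using assms by (metis SO3_inverse(3))+
  ultimately show ?thesis
    by (simp add: output_consensus_iff agents_def transpose_mat del: One_nat_def transpose_matrix_vector)
qed

lemma output_consensus_nonempty:
  assumes y: "norm (y (1,2)) = 1" "norm (y (1,3)) = 1" "norm (y (2,3)) = 1"
    and E: "E \<in> perturbations" and pos: "perturbed_gram y E > 0"
  shows "output_consensus y E \<noteq> {}"
proof -
  have "norm (E (1,2) *v y (1,2)) = 1" "norm (E (1,3) *v y (1,3)) = 1" "norm (E (2,1) *v y (1,2)) = 1"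
    "norm (E (2,3) *v y (2,3)) = 1" "norm (E (3,1) *v y (1,3)) = 1" "norm (E (3,2) *v y (2,3)) = 1"
    using perturbations_SO3[OF E] y by (simp_all only: SO3_norm)
  from aligning_rotations[OF this power_one pos[unfolded perturbed_gram_def]] obtain Q2 Q3 x where
    "Q2 \<in> SO3" "Q3 \<in> SO3"
    "Q2 *v (E (1,2) *v y (1,2)) = E (2,1) *v y (1,2)" "Q2 *v x = E (2,3) *v y (2,3)"
    "Q3 *v (E (1,3) *v y (1,3)) = E (3,1) *v y (1,3)" "Q3 *v x = E (3,2) *v y (2,3)" .
  from output_consensusI[OF this] show ?thesis by blast
qed

lemma state_consensus_const: "(\<lambda>i\<in>agents. mat 1) \<in> state_consensus"
  using SO3_one by (auto simp: state_consensus_def configurations_def agents_def)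

lemma set_dist_le:
  assumes "P \<in> A" "Q \<in> B"
  shows "set_dist A B \<le> sqrt (\<Sum>i\<in>agents. (frob_norm (P i - Q i))\<^sup>2)"
proof -
  have "(INF (P, Q) \<in> A \<times> B. \<Sum>i\<in>agents. (frob_norm (P i - Q i))\<^sup>2) \<le> (\<Sum>i\<in>agents. (frob_norm (P i - Q i))\<^sup>2)"
    using assms by (intro cINF_lower2[of _ _ "(P, Q)"] bdd_belowI2[of _ 0]) (auto intro!: sum_nonneg)
  then show ?thesis by (simp add: set_dist_def)
qed

lemma set_dist_ge:
  assumes "A \<noteq> {}" "B \<noteq> {}"
    and "\<And>P Q. P \<in> A \<Longrightarrow> Q \<in> B \<Longrightarrow> c \<le> sqrt (\<Sum>i\<in>agents. (frob_norm (P i - Q i))\<^sup>2)"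
  shows "c \<le> set_dist A B"
proof (cases "c \<ge> 0")
  case True
  have "c\<^sup>2 \<le> (INF (P, Q) \<in> A \<times> B. \<Sum>i\<in>agents. (frob_norm (P i - Q i))\<^sup>2)"
  proof (rule cINF_greatest)
    fix x assume "x \<in> A \<times> B"
    then obtain P Q where x: "x = (P, Q)" "P \<in> A" "Q \<in> B" by auto
    have "c\<^sup>2 \<le> (sqrt (\<Sum>i\<in>agents. (frob_norm (P i - Q i))\<^sup>2))\<^sup>2"
      using assms(3)[OF x(2,3)] True by (rule power_mono)
    then show "c\<^sup>2 \<le> (case x of (P, Q) \<Rightarrow> \<Sum>i\<in>agents. (frob_norm (P i - Q i))\<^sup>2)"
      by (simp add: x sum_nonneg)
  qed (use assms in auto)
  then show ?thesis unfolding set_dist_def by (rule real_le_rsqrt)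
next
  case False
  have "0 \<le> (INF (P, Q) \<in> A \<times> B. \<Sum>i\<in>agents. (frob_norm (P i - Q i))\<^sup>2)"
    using assms by (intro cINF_greatest) (auto intro!: sum_nonneg)
  then have "0 \<le> set_dist A B" by (simp add: set_dist_def)
  then show ?thesis using False by linarith
qed

lemma sqrt_perturbed_gram_le:
  assumes y: "norm (y (1,2)) = 1" "norm (y (1,3)) = 1" "norm (y (2,3)) = 1"
    and flat: "y (1,2) \<bullet> cross3 (y (1,3)) (y (2,3)) = 0"
    and E: "E \<in> small_perturbations \<epsilon>"
    and P: "P \<in> state_consensus" and Q: "Q \<in> output_consensus y E"
  shows "sqrt (perturbed_gram y E) \<le> 3 * (sqrt (\<Sum>i\<in>agents. (frob_norm (P i - Q i))\<^sup>2) + \<epsilon>)"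
proof -
  define R where "R = transpose (P 1)"
  let ?d = "sqrt (\<Sum>i\<in>agents. (frob_norm (P i - Q i))\<^sup>2)"
  have Ep: "E \<in> perturbations" and Ee: "\<And>a. a \<in> arcs \<Longrightarrow> norm (mat 1 - E a) < \<epsilon>"
    using E by (auto simp: small_perturbations_def frob_norm_eq_norm)
  have RS: "R \<in> SO3" and PR: "P i = transpose R" if "i \<in> agents" for i
    using P configurations_SO3[of P] SO3_transpose that
    by (auto simp: state_consensus_def R_def transpose_transpose agents_def)
  have R: "R \<in> SO3" using RS[of 1] by (simp add: agents_def)
  have Qc: "Q \<in> configurations" using Q by (simp add: output_consensus_iff)
  have d: "norm (P i - Q i) \<le> ?d" if "i \<in> agents" for i
  proof -
    have "(norm (P i - Q i))\<^sup>2 \<le> (\<Sum>i\<in>agents. (frob_norm (P i - Q i))\<^sup>2)"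
      using that unfolding frob_norm_eq_norm by (intro member_le_sum) (auto simp: agents_def)
    then show ?thesis by (rule real_le_rsqrt)
  qed
  have near: "norm (transpose (Q i) *v (E a *v z) - R *v z) \<le> ?d + \<epsilon>"
    if "i \<in> agents" "a \<in> arcs" "norm z = 1" for i a and z :: vec3
  proof -
    have QS: "transpose (Q i) \<in> SO3" using Qc that by (auto simp: configurations_def intro: SO3_transpose)
    have "transpose (Q i) *v (E a *v z) - R *v z
        = transpose (Q i) *v ((E a - mat 1) *v z) + (transpose (Q i) - R) *v z"
      by (simp add: matrix_vector_mult_diff_rdistrib matrix_vector_mult_diff_distrib del: transpose_matrix_vector)
    also have "norm \<dots> \<le> norm ((E a - mat 1) *v z) + norm ((transpose (Q i) - R) *v z)"
      by (metis SO3_norm[OF QS] norm_triangle_ineq)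
    also have "\<dots> \<le> norm (E a - mat 1) + norm (transpose (Q i) - R)"
      using norm_matrix_vector_mult_le[of "E a - mat 1" z] norm_matrix_vector_mult_le[of "transpose (Q i) - R" z] that
      by simp
    also have "transpose (Q i) - R = transpose (Q i - P i)"
      using PR[OF that(1)] by (simp add: transpose_def vec_eq_iff)
    finally show ?thesis
      using Ee[OF that(2)] d[OF that(1)] by (simp add: norm_transpose_mat3 norm_minus_commute)
  qed
  have 0: "(R *v y (1,2)) \<bullet> cross3 (R *v y (1,3)) (R *v y (2,3)) = 0"
  proof -
    have "rotation_matrix R" using R by (simp add: SO3_def)
    then show ?thesis by (simp only: cross_rotation_matrix SO3_inner[OF R] flat)
  qed
  have QS: "transpose (Q 1) \<in> SO3" "transpose (Q 2) \<in> SO3"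
    using Qc configurations_SO3 SO3_transpose by auto
  have m: "1 \<in> agents" "2 \<in> agents" "(1,2) \<in> arcs" "(1,3) \<in> arcs" "(2,3) \<in> arcs"
    by (auto simp: agents_def arcs_def)
  have "\<bar>(transpose (Q 1) *v (E (1,2) *v y (1,2))) \<bullet>
     cross3 (transpose (Q 1) *v (E (1,3) *v y (1,3))) (transpose (Q 2) *v (E (2,3) *v y (2,3)))
     - (R *v y (1,2)) \<bullet> cross3 (R *v y (1,3)) (R *v y (2,3))\<bar> \<le> 3 * (?d + \<epsilon>)"
    using QS R perturbations_SO3[OF Ep] y m
    by (intro triple_product_Lipschitz near) (simp_all only: SO3_norm)
  then show ?thesis
    using output_consensus_perturbed_gram[OF y Ep Q] 0 by (simp only: real_sqrt_abs diff_zero)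
qed

lemma continuous_perturbed_gram: "continuous_on UNIV (perturbed_gram y)"
proof -
  have *: "continuous_on UNIV (\<lambda>E :: nat \<times> nat \<Rightarrow> mat3. E a *v z)" for a and z :: vec3
    unfolding matrix_vector_mult_def by (intro continuous_intros continuous_on_product_coordinates)
  show ?thesis
    unfolding perturbed_gram_def gram_def by (intro continuous_intros *)
qed

lemma open_near_identity: "open {E :: nat \<times> nat \<Rightarrow> mat3. \<forall>a\<in>arcs. frob_norm (mat 1 - E a) < \<epsilon>}"
proof -
  have "open {E :: nat \<times> nat \<Rightarrow> mat3. frob_norm (mat 1 - E a) < \<epsilon>}" for a
    unfolding frob_norm_eq_norm
    by (intro open_Collect_less continuous_intros continuous_on_product_coordinates)
  then have "open (\<Inter>a\<in>arcs. {E :: nat \<times> nat \<Rightarrow> mat3. frob_norm (mat 1 - E a) < \<epsilon>})"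
    by (intro open_INT finite_arcs) auto
  then show ?thesis by (simp add: Collect_ball_eq)
qed

lemma small_perturbations_open_pos:
  assumes "haar_SO3 \<mu>" "open W" "E \<in> W" "E \<in> small_perturbations \<epsilon>"
  obtains S where "S \<in> sets (\<Pi>\<^sub>M a\<in>arcs. \<mu>)" "S \<subseteq> small_perturbations \<epsilon>" "S \<subseteq> W"
    "emeasure (\<Pi>\<^sub>M a\<in>arcs. \<mu>) S \<noteq> 0"
proof -
  have "open (W \<inter> {E. \<forall>a\<in>arcs. frob_norm (mat 1 - E a) < \<epsilon>})"
    by (intro open_Int assms open_near_identity)
  moreover have "E \<in> W \<inter> {E. \<forall>a\<in>arcs. frob_norm (mat 1 - E a) < \<epsilon>}" "E \<in> perturbations"
    using assms by (auto simp: small_perturbations_def)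
  ultimately obtain S where "S \<in> sets (\<Pi>\<^sub>M a\<in>arcs. \<mu>)"
    "S \<subseteq> (W \<inter> {E. \<forall>a\<in>arcs. frob_norm (mat 1 - E a) < \<epsilon>}) \<inter> perturbations"
    "emeasure (\<Pi>\<^sub>M a\<in>arcs. \<mu>) S \<noteq> 0"
    by (rule open_perturbations_pos[OF assms(1)])
  then show ?thesis by (intro that) (auto simp: small_perturbations_def)
qed

subsection \<open>Rotating one output within the plane of the reference vectors\<close>

definition plane_rotation :: "vec3 \<Rightarrow> vec3 \<Rightarrow> real \<Rightarrow> mat3" where
  "plane_rotation u v t = frame (u, v) **
     vector [vector [cos t, - sin t, 0], vector [sin t, cos t, 0], vector [0, 0, 1]] ** transpose (frame (u, v))"

lemma plane_rotation:
  assumes "norm u = 1" "norm v = 1" "cross3 u v \<noteq> 0"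
  shows "plane_rotation u v t \<in> SO3"
    and "(plane_rotation u v t *v u) \<bullet> v = (u \<bullet> v) * cos t + sqrt (1 - (u \<bullet> v)\<^sup>2) * sin t"
    and "frob_norm (mat 1 - plane_rotation u v t) \<le> 2 * \<bar>t\<bar>"
proof -
  define Z :: mat3 where "Z = vector [vector [cos t, - sin t, 0], vector [sin t, cos t, 0], vector [0, 0, 1]]"
  let ?A = "frame (u, v)"
  have R: "plane_rotation u v t = ?A ** Z ** transpose ?A" by (simp add: plane_rotation_def Z_def)
  note A = frame_in_SO3_unit[OF assms]
  have cs: "(sin t)\<^sup>2 + (cos t)\<^sup>2 = 1" by simp
  have "Z \<in> SO3"
    using cs by (simp add: Z_def SO3_def rotation_matrix_def orthogonal_matrix matrix_matrix_mult_def
        transpose_def mat_def vec_eq_iff forall_3 sum_3 det_3 power2_eq_square add.commute)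
  then show "plane_rotation u v t \<in> SO3" unfolding R by (intro SO3_mult SO3_transpose A)
  have "(plane_rotation u v t *v u) \<bullet> v = (?A *v (Z *v (transpose ?A *v u))) \<bullet> (?A *v (transpose ?A *v v))"
    unfolding R by (simp only: matrix_vector_mul_assoc[symmetric] SO3_inverse(4)[OF A])
  also have "\<dots> = (Z *v vector [1, 0, 0]) \<bullet> vector [u \<bullet> v, sqrt (1 - (u \<bullet> v)\<^sup>2), 0]"
    unfolding SO3_inner[OF A] frame_coordinates[OF assms] ..
  also have "\<dots> = (u \<bullet> v) * cos t + sqrt (1 - (u \<bullet> v)\<^sup>2) * sin t"
    by (simp add: Z_def matrix_vector_mult_def inner_vec_def sum_3)
  finally show "(plane_rotation u v t *v u) \<bullet> v = (u \<bullet> v) * cos t + sqrt (1 - (u \<bullet> v)\<^sup>2) * sin t" .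
  have "mat 1 - plane_rotation u v t = (?A - ?A ** Z) ** transpose ?A"
    by (simp add: R matrix_diff_rdistrib SO3_inverse(2)[OF A])
  moreover have "?A - ?A ** Z = ?A ** (mat 1 - Z)"
    by (simp add: vec_eq_iff matrix_matrix_mult_def sum_3 mat_def forall_3 algebra_simps)
  ultimately have "frob_norm (mat 1 - plane_rotation u v t) = frob_norm (mat 1 - Z)"
    by (simp add: frob_norm_mult_SO3 A SO3_transpose)
  also have "\<dots> = sqrt (4 * (1 - cos t))"
  proof -
    have "(1 - cos t)\<^sup>2 + (sin t)\<^sup>2 = 2 * (1 - cos t)"
      using cs by (simp add: power2_eq_square algebra_simps)
    then show ?thesis
      by (simp add: frob_norm_eq_norm norm_vec_def L2_set_def sum_3 Z_def mat_def)
  qed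
  also have "\<dots> \<le> sqrt ((2 * \<bar>t\<bar>)\<^sup>2)"
  proof (rule real_sqrt_le_mono)
    have "1 - cos t = 2 * (sin (t / 2))\<^sup>2" using cos_double_sin[of "t / 2"] by simp
    moreover have "(sin (t / 2))\<^sup>2 \<le> (t / 2)\<^sup>2"
      using abs_sin_x_le_abs_x[of "t / 2"] by (rule abs_le_square_iff[THEN iffD1])
    ultimately show "4 * (1 - cos t) \<le> (2 * \<bar>t\<bar>)\<^sup>2"
      by (simp add: power2_eq_square) (smt (verit) zero_le_square)
  qed
  finally show "frob_norm (mat 1 - plane_rotation u v t) \<le> 2 * \<bar>t\<bar>"
    by (simp only: real_sqrt_abs abs_mult abs_numeral abs_idempotent)
qed

lemma DERIV_at_zero_growth:
  fixes D :: "real \<Rightarrow> real"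
  assumes "(D has_real_derivative d) (at 0)" "D 0 = 0" "d \<noteq> 0"
  obtains r where "r > 0" "\<And>t. 0 < t \<Longrightarrow> t < r \<Longrightarrow> D (sgn d * t) \<ge> \<bar>d\<bar> / 2 * t"
    "\<And>t. 0 < t \<Longrightarrow> t < r \<Longrightarrow> D (- sgn d * t) < 0"
proof -
  have "((\<lambda>h. D h / h) \<longlongrightarrow> d) (at 0)"
    using assms(1,2) by (simp add: has_field_derivative_iff)
  moreover have "\<bar>d\<bar> / 2 > 0" using assms(3) by simp
  ultimately have "\<forall>\<^sub>F h in at 0. dist (D h / h) d < \<bar>d\<bar> / 2" by (rule tendstoD)
  then obtain r where r: "r > 0" "\<And>h. h \<noteq> 0 \<Longrightarrow> \<bar>h\<bar> < r \<Longrightarrow> \<bar>D h / h - d\<bar> < \<bar>d\<bar> / 2"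
    unfolding eventually_at dist_real_def by auto
  show ?thesis
  proof
    fix t assume t: "0 < t" "t < r"
    show "D (sgn d * t) \<ge> \<bar>d\<bar> / 2 * t" "D (- sgn d * t) < 0"
      using r(2)[of t] r(2)[of "- t"] t assms(3)
      by (cases "d > 0"; simp add: abs_if field_simps split: if_splits)+
  qed (use r in auto)
qed

lemma perturbed_gram_linear_growth:
  assumes y: "norm (y (1,2)) = 1" "norm (y (1,3)) = 1" "norm (y (2,3)) = 1"
    and flat: "y (1,2) \<bullet> cross3 (y (1,3)) (y (2,3)) = 0"
    and nz: "cross3 (y (1,2)) (y (1,3)) \<noteq> 0" "cross3 (y (1,2)) (y (2,3)) \<noteq> 0" "cross3 (y (1,3)) (y (2,3)) \<noteq> 0"
  obtains k r where "k > 0" "r > 0"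
    "\<And>\<epsilon>. 0 < \<epsilon> \<Longrightarrow> \<epsilon> < r \<Longrightarrow> \<exists>E\<in>small_perturbations \<epsilon>. perturbed_gram y E > k * \<epsilon>"
    "\<And>\<epsilon>. 0 < \<epsilon> \<Longrightarrow> \<epsilon> < r \<Longrightarrow> \<exists>E\<in>small_perturbations \<epsilon>. perturbed_gram y E < 0"
proof -
  let ?a = "y (1,2) \<bullet> y (1,3)" and ?b = "y (1,2) \<bullet> y (2,3)" and ?c = "y (1,3) \<bullet> y (2,3)"
  let ?q = "sqrt (1 - ?a\<^sup>2)"
  define D where "D t = gram (?a * cos t + ?q * sin t) ?b ?c" for t
  have lt: "?a\<^sup>2 < 1" "?b\<^sup>2 < 1" "?c\<^sup>2 < 1" using cross_unit_nonzero y nz by blast+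
  have D0: "D 0 = 0" using triple_product_sq[OF y] flat by (simp add: D_def)
  have "(?a - ?b * ?c)\<^sup>2 = (1 - ?b\<^sup>2) * (1 - ?c\<^sup>2)"
    using D0 gram_factor(1)[of ?a ?b ?c] by (simp add: D_def)
  also have "\<dots> > 0" using lt by simp
  finally have ne: "?a - ?b * ?c \<noteq> 0" by auto
  define d where "d = 2 * ?q * (?b * ?c - ?a)"
  have "?q > 0" using lt by simp
  then have d: "d \<noteq> 0" unfolding d_def using ne by auto
  have Dd: "(D has_real_derivative d) (at 0)"
    unfolding D_def gram_def d_def by (auto intro!: derivative_eq_intros simp: algebra_simps)
  obtain r where r: "r > 0" "\<And>t. 0 < t \<Longrightarrow> t < r \<Longrightarrow> D (sgn d * t) \<ge> \<bar>d\<bar> / 2 * t"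
    "\<And>t. 0 < t \<Longrightarrow> t < r \<Longrightarrow> D (- sgn d * t) < 0"
    by (rule DERIV_at_zero_growth[OF Dd D0 d]) blast
  define E where "E t = (\<lambda>a\<in>arcs. if a = (1,2) then plane_rotation (y (1,2)) (y (1,3)) t else mat 1)" for t
  note R = plane_rotation[OF y(1,2) nz(1)]
  have Dg: "perturbed_gram y (E t) = D t" for t
    using R(2)[of t] by (simp add: perturbed_gram_def E_def D_def arcs_def agents_def)
  have Es: "E t \<in> small_perturbations \<epsilon>" if "2 * \<bar>t\<bar> < \<epsilon>" for t \<epsilon>
    using R(1,3)[of t] SO3_one that
    by (auto simp: small_perturbations_def perturbations_def E_def frob_norm_eq_norm)
  show ?thesis
  proof
    show "\<bar>d\<bar> / 12 > 0" "r > 0" using d r by auto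
    fix \<epsilon> :: real assume e: "0 < \<epsilon>" "\<epsilon> < r"
    have s: "2 * \<bar>sgn d * (\<epsilon> / 4)\<bar> < \<epsilon>" "2 * \<bar>- sgn d * (\<epsilon> / 4)\<bar> < \<epsilon>"
      using d e by (simp_all add: abs_mult abs_sgn_eq)
    have "\<bar>d\<bar> / 12 * \<epsilon> < \<bar>d\<bar> / 2 * (\<epsilon> / 4)" using d e by simp
    also have "\<dots> \<le> D (sgn d * (\<epsilon> / 4))" using r(2)[of "\<epsilon> / 4"] e by simp
    finally show "\<exists>E\<in>small_perturbations \<epsilon>. perturbed_gram y E > \<bar>d\<bar> / 12 * \<epsilon>"
      using Es[OF s(1)] Dg by metis
    have "D (- sgn d * (\<epsilon> / 4)) < 0" using r(3)[of "\<epsilon> / 4"] e by simp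
    then show "\<exists>E\<in>small_perturbations \<epsilon>. perturbed_gram y E < 0"
      using Es[OF s(2)] Dg by metis
  qed
qed

subsection \<open>Distance between the consensus sets\<close>

lemma coplanar_distance:
  assumes y: "norm (y (1,2)) = 1" "norm (y (1,3)) = 1" "norm (y (2,3)) = 1"
    and flat: "y (1,2) \<bullet> cross3 (y (1,3)) (y (2,3)) = 0"
    and nz: "cross3 (y (1,2)) (y (1,3)) \<noteq> 0" "cross3 (y (1,2)) (y (2,3)) \<noteq> 0" "cross3 (y (1,3)) (y (2,3)) \<noteq> 0"
    and \<mu>: "haar_SO3 \<mu>"
  shows "\<exists>c>0. \<forall>\<^sub>F \<epsilon> in at_right 0. \<exists>S\<in>sets (\<Pi>\<^sub>M a\<in>arcs. \<mu>).
           S \<subseteq> small_perturbations \<epsilon> \<and> emeasure (\<Pi>\<^sub>M a\<in>arcs. \<mu>) S \<noteq> 0 \<and>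
           (\<forall>E\<in>S. output_consensus y E \<noteq> {} \<and>
                  set_dist state_consensus (output_consensus y E) \<ge> c * sqrt \<epsilon>)"
proof -
  obtain k r where k: "k > 0" "r > 0"
    "\<And>\<epsilon>. 0 < \<epsilon> \<Longrightarrow> \<epsilon> < r \<Longrightarrow> \<exists>E\<in>small_perturbations \<epsilon>. perturbed_gram y E > k * \<epsilon>"
    using perturbed_gram_linear_growth[OF y flat nz] by metis
  have "\<exists>S\<in>sets (\<Pi>\<^sub>M a\<in>arcs. \<mu>).
      S \<subseteq> small_perturbations \<epsilon> \<and> emeasure (\<Pi>\<^sub>M a\<in>arcs. \<mu>) S \<noteq> 0 \<and>
      (\<forall>E\<in>S. output_consensus y E \<noteq> {} \<and>
        set_dist state_consensus (output_consensus y E) \<ge> (sqrt k / 6) * sqrt \<epsilon>)"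
    if e: "0 < \<epsilon>" "\<epsilon> < r" "\<epsilon> < k / 36" for \<epsilon>
  proof -
    obtain E where "E \<in> small_perturbations \<epsilon>" "E \<in> {E. perturbed_gram y E > k * \<epsilon>}"
      using k(3)[OF e(1,2)] by auto
    moreover have "open {E. perturbed_gram y E > k * \<epsilon>}"
      by (intro open_Collect_less continuous_intros continuous_perturbed_gram)
    ultimately obtain S where S: "S \<in> sets (\<Pi>\<^sub>M a\<in>arcs. \<mu>)" "S \<subseteq> small_perturbations \<epsilon>"
      "S \<subseteq> {E. perturbed_gram y E > k * \<epsilon>}" "emeasure (\<Pi>\<^sub>M a\<in>arcs. \<mu>) S \<noteq> 0"
      using small_perturbations_open_pos[OF \<mu>] by metis
    have "output_consensus y E \<noteq> {} \<and>
        (sqrt k / 6) * sqrt \<epsilon> \<le> set_dist state_consensus (output_consensus y E)" if E: "E \<in> S" for E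
    proof
      have Es: "E \<in> small_perturbations \<epsilon>" and Eg: "perturbed_gram y E > k * \<epsilon>" using E S by auto
      have "0 < k * \<epsilon>" using k e by simp
      with Es Eg show ne: "output_consensus y E \<noteq> {}"
        by (intro output_consensus_nonempty y) (auto simp: small_perturbations_def)
      show "(sqrt k / 6) * sqrt \<epsilon> \<le> set_dist state_consensus (output_consensus y E)"
      proof (rule set_dist_ge[OF _ ne])
        fix P Q assume P: "P \<in> state_consensus" and Q: "Q \<in> output_consensus y E"
        have "sqrt k * sqrt \<epsilon> \<le> sqrt (perturbed_gram y E)"
          using Eg by (simp flip: real_sqrt_mult)
        also have "\<dots> \<le> 3 * (sqrt (\<Sum>i\<in>agents. (frob_norm (P i - Q i))\<^sup>2) + \<epsilon>)"
          by (rule sqrt_perturbed_gram_le[OF y flat Es P Q])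
        finally have 1: "sqrt k * sqrt \<epsilon> \<le> 3 * sqrt (\<Sum>i\<in>agents. (frob_norm (P i - Q i))\<^sup>2) + 3 * \<epsilon>"
          by simp
        have "6 * \<epsilon> = sqrt (36 * \<epsilon>) * sqrt \<epsilon>"
          using e by (simp add: real_sqrt_mult)
        also have "\<dots> \<le> sqrt k * sqrt \<epsilon>"
          using e by (intro mult_right_mono real_sqrt_le_mono) auto
        finally show "(sqrt k / 6) * sqrt \<epsilon> \<le> sqrt (\<Sum>i\<in>agents. (frob_norm (P i - Q i))\<^sup>2)"
          using 1 by linarith
      qed (use state_consensus_const in auto)
    qed
    then show ?thesis using S by blast
  qed
  moreover have "\<forall>\<^sub>F \<epsilon> in at_right 0. 0 < \<epsilon> \<and> \<epsilon> < min r (k / 36)"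
    using k eventually_at_right_real[of 0 "min r (k / 36)"] by (simp add: eventually_conj_iff)
  ultimately show ?thesis
    using k(1) by (intro exI[of _ "sqrt k / 6"]) (auto elim!: eventually_mono)
qed

lemma coplanar_no_consensus:
  assumes y: "norm (y (1,2)) = 1" "norm (y (1,3)) = 1" "norm (y (2,3)) = 1"
    and flat: "y (1,2) \<bullet> cross3 (y (1,3)) (y (2,3)) = 0"
    and nz: "cross3 (y (1,2)) (y (1,3)) \<noteq> 0" "cross3 (y (1,2)) (y (2,3)) \<noteq> 0" "cross3 (y (1,3)) (y (2,3)) \<noteq> 0"
    and \<mu>: "haar_SO3 \<mu>" and e: "\<epsilon> > 0"
  shows "\<exists>N\<in>sets (\<Pi>\<^sub>M a\<in>arcs. \<mu>). N \<subseteq> small_perturbations \<epsilon> \<and> emeasure (\<Pi>\<^sub>M a\<in>arcs. \<mu>) N \<noteq> 0 \<and>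
           (\<forall>E\<in>N. output_consensus y E = {})"
proof -
  obtain r where r: "r > 0"
    "\<And>\<epsilon>. 0 < \<epsilon> \<Longrightarrow> \<epsilon> < r \<Longrightarrow> \<exists>E\<in>small_perturbations \<epsilon>. perturbed_gram y E < 0"
    using perturbed_gram_linear_growth[OF y flat nz] by metis
  define \<delta> where "\<delta> = min \<epsilon> (r / 2)"
  have \<delta>: "0 < \<delta>" "\<delta> < r" "\<delta> \<le> \<epsilon>" using e r(1) by (auto simp: \<delta>_def)
  then obtain E where "E \<in> small_perturbations \<delta>" "E \<in> {E. perturbed_gram y E < 0}"
    using r(2) by auto
  moreover have "open {E. perturbed_gram y E < 0}"
    by (intro open_Collect_less continuous_intros continuous_perturbed_gram)
  ultimately obtain N where N: "N \<in> sets (\<Pi>\<^sub>M a\<in>arcs. \<mu>)" "N \<subseteq> small_perturbations \<delta>"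
    "N \<subseteq> {E. perturbed_gram y E < 0}" "emeasure (\<Pi>\<^sub>M a\<in>arcs. \<mu>) N \<noteq> 0"
    using small_perturbations_open_pos[OF \<mu>] by metis
  have "small_perturbations \<delta> \<subseteq> small_perturbations \<epsilon>"
    using \<delta>(3) by (auto simp: small_perturbations_def)
  moreover have "output_consensus y E = {}" if "E \<in> N" for E
  proof -
    have "perturbed_gram y E < 0" "E \<in> perturbations"
      using that N by (auto simp: small_perturbations_def)
    then show ?thesis using output_consensus_perturbed_gram[OF y] by fastforce
  qed
  ultimately show ?thesis using N by blast
qed

lemma independent_distance:
  assumes y: "norm (y (1,2)) = 1" "norm (y (1,3)) = 1" "norm (y (2,3)) = 1"
    and vol: "y (1,2) \<bullet> cross3 (y (1,3)) (y (2,3)) \<noteq> 0"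
  shows "\<exists>c>0. \<forall>\<^sub>F \<epsilon> in at_right 0. \<forall>E\<in>small_perturbations \<epsilon>.
           output_consensus y E \<noteq> {} \<and> set_dist state_consensus (output_consensus y E) \<le> c * \<epsilon>"
proof -
  have "y (2,3) \<bullet> cross3 (y (1,2)) (y (1,3)) \<noteq> 0"
    using vol by (metis cross_triple inner_commute)
  from aligning_rotations_near[OF y this] obtain L d where L: "L > 0" and d: "d > 0" and near:
    "\<And>a12 a13 a21 a23 a31 a32 e. \<lbrakk>norm a12 = 1; norm a13 = 1; norm a21 = 1; norm a23 = 1; norm a31 = 1; norm a32 = 1;
       norm (a12 - y (1,2)) \<le> e; norm (a13 - y (1,3)) \<le> e; norm (a21 - y (1,2)) \<le> e; norm (a23 - y (2,3)) \<le> e;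
       norm (a31 - y (1,3)) \<le> e; norm (a32 - y (2,3)) \<le> e; e < d\<rbrakk> \<Longrightarrow>
       \<exists>Q2\<in>SO3. \<exists>Q3\<in>SO3. \<exists>x. Q2 *v a12 = a21 \<and> Q2 *v x = a23 \<and> Q3 *v a13 = a31 \<and> Q3 *v x = a32 \<and>
         frob_norm (Q2 - mat 1) \<le> L * e \<and> frob_norm (Q3 - mat 1) \<le> L * e"
    by blast
  have "output_consensus y E \<noteq> {} \<and> set_dist state_consensus (output_consensus y E) \<le> 2 * L * \<epsilon>"
    if e: "0 < \<epsilon>" "\<epsilon> < d" and E: "E \<in> small_perturbations \<epsilon>" for \<epsilon> E
  proof -
    have n: "norm (E a *v z) = 1" "norm (E a *v z - z) \<le> \<epsilon>" if "a \<in> arcs" "norm z = 1" for a z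
    proof -
      have "E a \<in> SO3" using E that by (auto simp: small_perturbations_def perturbations_def)
      then show "norm (E a *v z) = 1" using SO3_norm that by simp
      have "norm (E a *v z - z) = norm ((mat 1 - E a) *v z)"
        by (simp add: matrix_vector_mult_diff_rdistrib norm_minus_commute)
      also have "\<dots> \<le> norm (mat 1 - E a)"
        using norm_matrix_vector_mult_le[of "mat 1 - E a" z] that by simp
      also have "\<dots> \<le> \<epsilon>" using E that by (auto simp: small_perturbations_def frob_norm_eq_norm intro: less_imp_le)
      finally show "norm (E a *v z - z) \<le> \<epsilon>" .
    qed
    have "(1,2) \<in> arcs" "(1,3) \<in> arcs" "(2,1) \<in> arcs" "(2,3) \<in> arcs" "(3,1) \<in> arcs" "(3,2) \<in> arcs"
      by (auto simp: arcs_def agents_def)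
    then obtain Q2 Q3 x where Q: "Q2 \<in> SO3" "Q3 \<in> SO3"
      "Q2 *v (E (1,2) *v y (1,2)) = E (2,1) *v y (1,2)" "Q2 *v x = E (2,3) *v y (2,3)"
      "Q3 *v (E (1,3) *v y (1,3)) = E (3,1) *v y (1,3)" "Q3 *v x = E (3,2) *v y (2,3)"
      and b: "frob_norm (Q2 - mat 1) \<le> L * \<epsilon>" "frob_norm (Q3 - mat 1) \<le> L * \<epsilon>"
      using near[of "E (1,2) *v y (1,2)" "E (1,3) *v y (1,3)" "E (2,1) *v y (1,2)" "E (2,3) *v y (2,3)"
        "E (3,1) *v y (1,3)" "E (3,2) *v y (2,3)" \<epsilon>] n y e(2) by blast
    let ?Q = "\<lambda>i\<in>agents. if i = 1 then mat 1 else if i = 2 then Q2 else Q3"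
    have Qo: "?Q \<in> output_consensus y E" by (rule output_consensusI[OF Q])
    have "set_dist state_consensus (output_consensus y E)
        \<le> sqrt (\<Sum>i\<in>agents. (frob_norm ((\<lambda>i\<in>agents. mat 1) i - ?Q i))\<^sup>2)"
      by (rule set_dist_le[OF state_consensus_const Qo])
    also have "\<dots> = sqrt ((frob_norm (Q2 - mat 1))\<^sup>2 + (frob_norm (Q3 - mat 1))\<^sup>2)"
      by (simp add: agents_def frob_norm_eq_norm norm_minus_commute)
    also have "\<dots> \<le> frob_norm (Q2 - mat 1) + frob_norm (Q3 - mat 1)"
      by (rule sqrt_sum_squares_le_sum) (simp_all add: frob_norm_eq_norm)
    also have "\<dots> \<le> 2 * L * \<epsilon>" using b by simp
    finally show ?thesis using Qo by blast
  qed
  moreover have "\<forall>\<^sub>F \<epsilon> in at_right 0. 0 < \<epsilon> \<and> \<epsilon> < d"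
    using d eventually_at_right_real[of 0 d] by simp
  ultimately show ?thesis
    using L by (intro exI[of _ "2 * L"]) (auto elim!: eventually_mono)
qed

theorem theorem5:
  fixes y :: "nat \<times> nat \<Rightarrow> real^3"
    and Q :: "(nat \<times> nat \<Rightarrow> real^3^3) \<Rightarrow> real \<Rightarrow> nat \<Rightarrow> real^3^3"
    and \<mu> :: "(real^3^3) measure"
  assumes "\<And>i j. (i, j) \<in> edges \<Longrightarrow> y (i, j) \<in> sphere 0 1 \<and> y (j, i) = y (i, j)"
    and "\<And>E. E \<in> perturbations \<Longrightarrow> consensus_flow y E (Q E)"
    and "haar_SO3 \<mu>"
  shows "(rank_of3 (y (1, 2)) (y (1, 3)) (y (2, 3)) = 2 \<and>
          rank_of2 (y (1, 2)) (y (1, 3)) = 2 \<and>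
          rank_of2 (y (1, 2)) (y (2, 3)) = 2 \<and>
          rank_of2 (y (1, 3)) (y (2, 3)) = 2 \<longrightarrow>
            (\<exists>c>0. \<forall>\<^sub>F \<epsilon> in at_right 0.
               \<exists>S\<in>sets (\<Pi>\<^sub>M a\<in>arcs. \<mu>).
                 S \<subseteq> small_perturbations \<epsilon> \<and> emeasure (\<Pi>\<^sub>M a\<in>arcs. \<mu>) S \<noteq> 0 \<and>
                 (\<forall>E\<in>S. output_consensus y E \<noteq> {} \<and>
                        set_dist state_consensus (output_consensus y E) \<ge> c * sqrt \<epsilon>)) \<and>
            (\<forall>\<epsilon>>0.
               \<exists>N\<in>sets (\<Pi>\<^sub>M a\<in>arcs. \<mu>).
                 N \<subseteq> small_perturbations \<epsilon> \<and> emeasure (\<Pi>\<^sub>M a\<in>arcs. \<mu>) N \<noteq> 0 \<and>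
                 (\<forall>E\<in>N. output_consensus y E = {}))) \<and>
         (rank_of3 (y (1, 2)) (y (1, 3)) (y (2, 3)) = 3 \<longrightarrow>
            (\<exists>c>0. \<forall>\<^sub>F \<epsilon> in at_right 0.
               \<forall>E\<in>small_perturbations \<epsilon>.
                 output_consensus y E \<noteq> {} \<and>
                 set_dist state_consensus (output_consensus y E) \<le> c * \<epsilon>))"
proof -
  have e: "(1, 2) \<in> edges" "(1, 3) \<in> edges" "(2, 3) \<in> edges" by (auto simp: edges_def)
  have y: "norm (y (1,2)) = 1" "norm (y (1,3)) = 1" "norm (y (2,3)) = 1"
    using assms(1)[OF e(1)] assms(1)[OF e(2)] assms(1)[OF e(3)] by simp_all
  show ?thesis
  proof (intro conjI impI)
    assume rank: "rank_of3 (y (1, 2)) (y (1, 3)) (y (2, 3)) = 2 \<and>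
          rank_of2 (y (1, 2)) (y (1, 3)) = 2 \<and>
          rank_of2 (y (1, 2)) (y (2, 3)) = 2 \<and>
          rank_of2 (y (1, 3)) (y (2, 3)) = 2"
    have "rank_of3 (y (1, 2)) (y (1, 3)) (y (2, 3)) \<noteq> 3" using rank by simp
    then have flat: "y (1, 2) \<bullet> cross3 (y (1, 3)) (y (2, 3)) = 0"
      by (simp only: rank_of3_eq_3_iff not_not)
    have nz: "cross3 (y (1, 2)) (y (1, 3)) \<noteq> 0" "cross3 (y (1, 2)) (y (2, 3)) \<noteq> 0"
      "cross3 (y (1, 3)) (y (2, 3)) \<noteq> 0"
      using rank rank_of2_eq_2_cross by auto
    show "\<exists>c>0. \<forall>\<^sub>F \<epsilon> in at_right 0.
               \<exists>S\<in>sets (\<Pi>\<^sub>M a\<in>arcs. \<mu>).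
                 S \<subseteq> small_perturbations \<epsilon> \<and> emeasure (\<Pi>\<^sub>M a\<in>arcs. \<mu>) S \<noteq> 0 \<and>
                 (\<forall>E\<in>S. output_consensus y E \<noteq> {} \<and>
                        set_dist state_consensus (output_consensus y E) \<ge> c * sqrt \<epsilon>)"
      by (rule coplanar_distance[OF y flat nz assms(3)])
    show "\<forall>\<epsilon>>0.
               \<exists>N\<in>sets (\<Pi>\<^sub>M a\<in>arcs. \<mu>).
                 N \<subseteq> small_perturbations \<epsilon> \<and> emeasure (\<Pi>\<^sub>M a\<in>arcs. \<mu>) N \<noteq> 0 \<and>
                 (\<forall>E\<in>N. output_consensus y E = {})"
      using coplanar_no_consensus[OF y flat nz assms(3)] by blast
  next
    assume "rank_of3 (y (1, 2)) (y (1, 3)) (y (2, 3)) = 3"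
    then have "y (1, 2) \<bullet> cross3 (y (1, 3)) (y (2, 3)) \<noteq> 0"
      by (rule rank_of3_eq_3_iff[THEN iffD1])
    then show "\<exists>c>0. \<forall>\<^sub>F \<epsilon> in at_right 0.
               \<forall>E\<in>small_perturbations \<epsilon>.
                 output_consensus y E \<noteq> {} \<and>
                 set_dist state_consensus (output_consensus y E) \<le> c * \<epsilon>"
      by (rule independent_distance[OF y])
  qed
qed

end
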